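(* In the setting below, let $T$ be an integral operator on $L^2(\mathbb{R}^d;\mu)$ with bounded kernel, and for $f,g\in L^2(\mathbb{R}^d;\mu)$ set $R_{(\omega_1,\omega_2)}(f,g)=(Tf_{bad},g)+(Tf_{good},g_{bad})$. Then $$\mathbb{E}\,|R_{(\omega_1,\omega_2)}(f,g)|\le2\delta\,\|T\|_{L^2(\mu)\to L^2(\mu)}\|f\|_{L^2(\mu)}\|g\|_{L^2(\mu)},$$ the expectation being over independent $\omega_1,\omega_2\in\Omega$.
   Context: Setting: $\mu$ a probability measure on $\mathbb{R}^d$ with compact support in $\frac14Q_*$, $Q_*$ a fixed unit cube; $H$ open. $\Omega=(-1/40,1/40]^d$ with normalized Lebesgue measure; $\mathcal{D}(\omega)$ is the set of dyadic subcubes of $\omega+Q_*$; $\mathcal{D}_1=\mathcal{D}(\omega_1)$, $\mathcal{D}_2=\mathcal{D}(\omega_2)$, $\omega_1,\omega_2$ independent. Terminal cubes: $2Q\subset H$ or $\mu(Q)=0$; transit otherwise. $\langle\psi\rangle_Q=\mu(Q)^{-1}\int_Q\psi\,d\mu$; $\Lambda\varphi=\langle\varphi\rangle$ over the whole support (the constant $\int\varphi\,d\mu$); for transit $Q$ with children $Q_j$: $\Delta_Q\varphi=0$ off $Q$, $=\langle\varphi\rangle_{Q_j}-\langle\varphi\rangle_Q$ on transit $Q_j$, $=\varphi-\langle\varphi\rangle_Q$ on terminal $Q_j$. Parameters $0<\tau\le1$, $m>0$, $\alpha=\tau/(2\tau+2m)$, $\delta>0$, $S\ge2$, $r$ with $2^{-r}\le\delta^S<2^{-r+1}$;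 $sk\,R=\bigcup_i\partial R_i$. $Q\in\mathcal{D}_1$ is bad if some $R\in\mathcal{D}_2$ has $\ell(R)\ge2^r\ell(Q)$ and $\operatorname{dist}(Q,sk\,R)<\ell(Q)^\alpha\ell(R)^{1-\alpha}$, good otherwise; symmetrically for $R\in\mathcal{D}_2$ relative to $\mathcal{D}_1$. $S$ and $\delta$ are chosen so that every fixed cube of one lattice is bad with probability at most $\delta^2$ over the shift of the other lattice. $f_{good}=\Lambda f+\sum_{Q\in\mathcal{D}_1\text{ transit, good}}\Delta_Qf$, $f_{bad}=\sum_{Q\in\mathcal{D}_1\text{ transit, bad}}\Delta_Qf$; $g_{good},g_{bad}$ likewise with $\mathcal{D}_2$. $(u,v)=\int u\bar v\,d\mu$. *)

theory Defs
  imports "HOL-Probability.Probability"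
begin

text \<open>Half-open cubes [a, a + l) in real^'n. The fixed unit cube Q_* is cube c 1.\<close>
definition cube :: "real^'n \<Rightarrow> real \<Rightarrow> (real^'n) set" where
  "cube a l = {x. \<forall>i. a$i \<le> x$i \<and> x$i < a$i + l}"

definition side :: "nat \<Rightarrow> real" where
  "side k = (1/2)^k"

text \<open>Indices of the dyadic subcubes of generation k of a unit cube.\<close>
definition idx :: "nat \<Rightarrow> (int^'n) set" where
  "idx k = {j. \<forall>i. 0 \<le> j$i \<and> j$i < 2^k}"

definition children :: "int^'n \<Rightarrow> (int^'n) set" where
  "children j = {j'. \<forall>i. j'$i = 2 * j$i \<or> j'$i = 2 * j$i + 1}"

text \<open>Corner of the dyadic cube (k,j) of the lattice D(\<omega>) (dyadic subcubes of \<omega> + Q_*).\<close>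
definition dcorner :: "real^'n \<Rightarrow> real^'n \<Rightarrow> nat \<Rightarrow> int^'n \<Rightarrow> real^'n" where
  "dcorner c \<omega> k j = \<omega> + c + side k *\<^sub>R (\<chi> i. of_int (j$i))"

definition dcube :: "real^'n \<Rightarrow> real^'n \<Rightarrow> nat \<Rightarrow> int^'n \<Rightarrow> (real^'n) set" where
  "dcube c \<omega> k j = cube (dcorner c \<omega> k j) (side k)"

definition dbl_dcube :: "real^'n \<Rightarrow> real^'n \<Rightarrow> nat \<Rightarrow> int^'n \<Rightarrow> (real^'n) set" where
  "dbl_dcube c \<omega> k j = cube (dcorner c \<omega> k j - (\<chi> i. side k / 2)) (2 * side k)"

definition terminal :: "real^'n \<Rightarrow> (real^'n) measure \<Rightarrow> (real^'n) set \<Rightarrow> real^'n \<Rightarrow> nat \<Rightarrow> int^'n \<Rightarrow> bool" where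
  "terminal c M H \<omega> k j \<longleftrightarrow> dbl_dcube c \<omega> k j \<subseteq> H \<or> measure M (dcube c \<omega> k j) = 0"

definition transit :: "real^'n \<Rightarrow> (real^'n) measure \<Rightarrow> (real^'n) set \<Rightarrow> real^'n \<Rightarrow> nat \<Rightarrow> int^'n \<Rightarrow> bool" where
  "transit c M H \<omega> k j \<longleftrightarrow> \<not> terminal c M H \<omega> k j"

definition avg :: "(real^'n) measure \<Rightarrow> (real^'n) set \<Rightarrow> (real^'n \<Rightarrow> complex) \<Rightarrow> complex" where
  "avg M Q \<phi> = (\<integral>x. indicator Q x *\<^sub>R \<phi> x \<partial>M) / complex_of_real (measure M Q)"

definition Lam :: "(real^'n) measure \<Rightarrow> (real^'n \<Rightarrow> complex) \<Rightarrow> complex" where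
  "Lam M \<phi> = (\<integral>x. \<phi> x \<partial>M)"

definition Delta :: "real^'n \<Rightarrow> (real^'n) measure \<Rightarrow> (real^'n) set \<Rightarrow> real^'n \<Rightarrow> nat \<Rightarrow> int^'n
    \<Rightarrow> (real^'n \<Rightarrow> complex) \<Rightarrow> real^'n \<Rightarrow> complex" where
  "Delta c M H \<omega> k j \<phi> x =
    (if x \<notin> dcube c \<omega> k j then 0
     else (let j' = (THE j'. j' \<in> children j \<and> x \<in> dcube c \<omega> (Suc k) j') in
           if transit c M H \<omega> (Suc k) j'
           then avg M (dcube c \<omega> (Suc k) j') \<phi> - avg M (dcube c \<omega> k j) \<phi>
           else \<phi> x - avg M (dcube c \<omega> k j) \<phi>))"

definition sk :: "real^'n \<Rightarrow> real^'n \<Rightarrow> nat \<Rightarrow> int^'n \<Rightarrow> (real^'n) set" where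
  "sk c \<omega> k j = (\<Union>j'\<in>children j. frontier (dcube c \<omega> (Suc k) j'))"

definition bad :: "real^'n \<Rightarrow> int \<Rightarrow> real \<Rightarrow> real^'n \<Rightarrow> real^'n \<Rightarrow> nat \<Rightarrow> int^'n \<Rightarrow> bool" where
  "bad c r \<alpha> \<omega>a \<omega>b k j \<longleftrightarrow>
    (\<exists>k'. \<exists>j'\<in>idx k'. side k' \<ge> 2 powr (real_of_int r) * side k \<and>
       setdist (dcube c \<omega>a k j) (sk c \<omega>b k' j') < side k powr \<alpha> * side k' powr (1 - \<alpha>))"

definition sq_int :: "(real^'n) measure \<Rightarrow> (real^'n \<Rightarrow> complex) \<Rightarrow> bool" where
  "sq_int M f \<longleftrightarrow> f \<in> borel_measurable M \<and> integrable M (\<lambda>x. (cmod (f x))^2)"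

definition L2norm :: "(real^'n) measure \<Rightarrow> (real^'n \<Rightarrow> complex) \<Rightarrow> real" where
  "L2norm M f = sqrt (\<integral>x. (cmod (f x))^2 \<partial>M)"

definition L2inner :: "(real^'n) measure \<Rightarrow> (real^'n \<Rightarrow> complex) \<Rightarrow> (real^'n \<Rightarrow> complex) \<Rightarrow> complex" where
  "L2inner M u v = (\<integral>x. u x * cnj (v x) \<partial>M)"

definition haar_psum :: "real^'n \<Rightarrow> (real^'n) measure \<Rightarrow> (real^'n) set \<Rightarrow> real^'n
    \<Rightarrow> (nat \<Rightarrow> int^'n \<Rightarrow> bool) \<Rightarrow> (real^'n \<Rightarrow> complex) \<Rightarrow> nat \<Rightarrow> real^'n \<Rightarrow> complex" where
  "haar_psum c M H \<omega> P f N x =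
     (\<Sum>k<N. \<Sum>j\<in>{j\<in>idx k. transit c M H \<omega> k j \<and> P k j}. Delta c M H \<omega> k j f x)"

definition haar_part :: "real^'n \<Rightarrow> (real^'n) measure \<Rightarrow> (real^'n) set \<Rightarrow> real^'n
    \<Rightarrow> (nat \<Rightarrow> int^'n \<Rightarrow> bool) \<Rightarrow> (real^'n \<Rightarrow> complex) \<Rightarrow> real^'n \<Rightarrow> complex" where
  "haar_part c M H \<omega> P f =
     (SOME h. sq_int M h \<and>
        (\<lambda>N. L2norm M (\<lambda>x. haar_psum c M H \<omega> P f N x - h x)) \<longlonglongrightarrow> 0)"

definition good_part where
  "good_part c M H r \<alpha> \<omega>a \<omega>b f =
     (\<lambda>x. Lam M f + haar_part c M H \<omega>a (\<lambda>k j. \<not> bad c r \<alpha> \<omega>a \<omega>b k j) f x)"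

definition bad_part where
  "bad_part c M H r \<alpha> \<omega>a \<omega>b f = haar_part c M H \<omega>a (\<lambda>k j. bad c r \<alpha> \<omega>a \<omega>b k j) f"

definition intop :: "(real^'n) measure \<Rightarrow> (real^'n \<Rightarrow> real^'n \<Rightarrow> complex)
    \<Rightarrow> (real^'n \<Rightarrow> complex) \<Rightarrow> real^'n \<Rightarrow> complex" where
  "intop M K f = (\<lambda>x. \<integral>y. K x y * f y \<partial>M)"

definition opnorm :: "(real^'n) measure \<Rightarrow> (real^'n \<Rightarrow> real^'n \<Rightarrow> complex) \<Rightarrow> real" where
  "opnorm M K = Sup {L2norm M (intop M K f) | f. sq_int M f \<and> L2norm M f \<le> 1}"

definition Omega :: "(real^'n) set" where
  "Omega = {w. \<forall>i. - 1/40 < w$i \<and> w$i \<le> 1/40}"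

definition POmega :: "(real^'n) measure" where
  "POmega = uniform_measure lborel Omega"

definition Rterm where
  "Rterm c M H r \<alpha> K \<omega>1 \<omega>2 f g =
     L2inner M (intop M K (bad_part c M H r \<alpha> \<omega>1 \<omega>2 f)) g
     + L2inner M (intop M K (good_part c M H r \<alpha> \<omega>1 \<omega>2 f)) (bad_part c M H r \<alpha> \<omega>2 \<omega>1 g)"

end

theory Submission
  imports Defs
begin

text \<open>
  The functions \<open>\<Delta>\<^sub>Q f\<close>, for \<open>Q\<close> ranging over the transit cubes of one lattice, have mean zero, are
  pairwise orthogonal and satisfy \<open>(f, \<Delta>\<^sub>Q f) = (\<Delta>\<^sub>Q f, \<Delta>\<^sub>Q f)\<close>. Hence \<open>f\<^sub>g\<^sub>o\<^sub>o\<^sub>d\<close> is a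
  limit of orthogonal projections of \<open>f\<close>, so its norm is at most that of \<open>f\<close>, and the squared
  norm of \<open>f\<^sub>b\<^sub>a\<^sub>d\<close> is the sum of the squared norms of \<open>\<Delta>\<^sub>Q f\<close> over the bad transit cubes. Both the
  family of these functions and the transit property depend on \<open>\<omega>\<^sub>1\<close> only, so integrating over
  \<open>\<omega>\<^sub>2\<close> first turns each badness indicator into a probability at most \<open>\<delta>\<^sup>2\<close>; Bessel's inequality and
  the Cauchy-Schwarz inequality then bound the mean norm of \<open>f\<^sub>b\<^sub>a\<^sub>d\<close> by \<open>\<delta>\<close> times the norm of \<open>f\<close>.
  The remainder is at most \<open>\<parallel>T\<parallel> (\<parallel>f\<^sub>b\<^sub>a\<^sub>d\<parallel> \<parallel>g\<parallel> + \<parallel>f\<parallel> \<parallel>g\<^sub>b\<^sub>a\<^sub>d\<parallel>)\<close>.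
\<close>

section \<open>Square-integrable functions\<close>

lemma measurable_cnj [measurable]: "cnj \<in> borel_measurable borel"
  by (intro borel_measurable_continuous_onI continuous_intros)

text \<open>The Cauchy-Schwarz inequality for non-negative integrals bounds a square. This removes
  the square when the left side might still be infinite; the finite right side excludes that
  case.\<close>

lemma ennreal_power2_le_imp_le:
  fixes a :: ennreal
  assumes "a\<^sup>2 \<le> (ennreal b)\<^sup>2" "0 \<le> b"
  shows "a \<le> ennreal b"
proof (cases a)
  case (real r)
  then have "r\<^sup>2 \<le> b\<^sup>2" using assms by (simp add: ennreal_power)
  then have "r \<le> b" using assms(2) by (rule power2_le_imp_le)
  then show ?thesis unfolding real(2) by (rule ennreal_leI)
next
  case top
  have "(ennreal b)\<^sup>2 < top" using assms(2) by (simp add: ennreal_power)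
  with assms(1) top show ?thesis by simp
qed

lemma sq_int_measurable: "sq_int M u \<Longrightarrow> u \<in> borel_measurable M"
  by (simp add: sq_int_def)

lemma sq_int_integrable_mult_cnj:
  assumes "sq_int M u" "sq_int M v"
  shows "integrable M (\<lambda>x. u x * cnj (v x))"
proof (rule Bochner_Integration.integrable_bound)
  show "integrable M (\<lambda>x. (cmod (u x))\<^sup>2 + (cmod (v x))\<^sup>2)"
    using assms by (auto simp: sq_int_def)
  show "(\<lambda>x. u x * cnj (v x)) \<in> borel_measurable M"
    using assms by (intro borel_measurable_times measurable_compose[OF _ measurable_cnj] sq_int_measurable)
  have "a * b \<le> a\<^sup>2 + b\<^sup>2" for a b :: real
    using sum_squares_bound[of a b] zero_le_power2[of a] zero_le_power2[of b] by linarith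
  then show "AE x in M. norm (u x * cnj (v x)) \<le> norm ((cmod (u x))\<^sup>2 + (cmod (v x))\<^sup>2)"
    by (simp add: norm_mult)
qed

lemma sq_int_add:
  assumes "sq_int M u" "sq_int M v"
  shows "sq_int M (\<lambda>x. u x + v x)"
proof -
  have "integrable M (\<lambda>x. (cmod (u x + v x))\<^sup>2)"
  proof (rule Bochner_Integration.integrable_bound)
    show "integrable M (\<lambda>x. 2 * ((cmod (u x))\<^sup>2 + (cmod (v x))\<^sup>2))"
      using assms by (auto simp: sq_int_def)
    show "(\<lambda>x. (cmod (u x + v x))\<^sup>2) \<in> borel_measurable M"
      using assms by (auto simp: sq_int_def)
    have "(cmod (a + b))\<^sup>2 \<le> 2 * ((cmod a)\<^sup>2 + (cmod b)\<^sup>2)" for a b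
    proof -
      have "(cmod (a + b))\<^sup>2 \<le> (cmod a + cmod b)\<^sup>2"
        by (simp add: norm_triangle_ineq power_mono)
      also have "\<dots> \<le> 2 * ((cmod a)\<^sup>2 + (cmod b)\<^sup>2)"
        using sum_squares_bound[of "cmod a" "cmod b"] by (simp add: power2_sum)
      finally show ?thesis .
    qed
    then show "AE x in M. norm ((cmod (u x + v x))\<^sup>2) \<le> norm (2 * ((cmod (u x))\<^sup>2 + (cmod (v x))\<^sup>2))"
      by simp
  qed
  then show ?thesis using assms by (auto simp: sq_int_def)
qed

lemma sq_int_cmult:
  assumes "sq_int M u"
  shows "sq_int M (\<lambda>x. a * u x)"
  using assms by (auto simp: sq_int_def norm_mult power_mult_distrib)

lemma sq_int_diff:
  assumes "sq_int M u" "sq_int M v"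
  shows "sq_int M (\<lambda>x. u x - v x)"
  using sq_int_add[OF assms(1) sq_int_cmult[OF assms(2), of "-1"]] by simp

lemma sq_int_zero: "sq_int M (\<lambda>x. 0)"
  by (simp add: sq_int_def)

lemma sq_int_sum:
  assumes "\<And>i. i \<in> I \<Longrightarrow> sq_int M (u i)"
  shows "sq_int M (\<lambda>x. \<Sum>i\<in>I. u i x)"
  using assms by (induction I rule: infinite_finite_induct) (auto simp: sq_int_zero sq_int_add)

lemma sq_int_indicator:
  assumes "sq_int M u" "A \<in> sets M"
  shows "sq_int M (\<lambda>x. indicator A x * u x)"
proof -
  have "(cmod (indicator A x * u x))\<^sup>2 = indicator A x *\<^sub>R (cmod (u x))\<^sup>2" for x
    by (simp add: indicator_def)
  then show ?thesis
    using assms integrable_mult_indicator[of A M "\<lambda>x. (cmod (u x))\<^sup>2"] by (auto simp: sq_int_def)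
qed

lemma sq_int_bounded:
  assumes "finite_measure M" "u \<in> borel_measurable M" "\<And>x. cmod (u x) \<le> B"
  shows "sq_int M u"
proof -
  interpret finite_measure M by fact
  have "integrable M (\<lambda>x. (cmod (u x))\<^sup>2)"
    using assms by (intro integrable_const_bound[of _ "B\<^sup>2"]) (auto intro!: power_mono)
  with assms(2) show ?thesis by (simp add: sq_int_def)
qed

lemma sq_int_integrable:
  assumes "finite_measure M" "sq_int M u"
  shows "integrable M u"
proof -
  have "sq_int M (\<lambda>x. 1)" by (rule sq_int_bounded[where B=1]) (auto simp: assms(1))
  from sq_int_integrable_mult_cnj[OF assms(2) this] show ?thesis by simp
qed

section \<open>Norm and inner product of L2\<close>

lemma L2norm_nonneg [simp]: "0 \<le> L2norm M u"
  by (simp add: L2norm_def)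

lemma L2norm_power2: "(L2norm M u)\<^sup>2 = (\<integral>x. (cmod (u x))\<^sup>2 \<partial>M)"
  by (simp add: L2norm_def)

text \<open>Bridge from Bochner integrals to non-negative ones. Square integrability matters,
  because the Bochner integral of a non-integrable function is 0 by default.\<close>

lemma ennreal_L2norm_power2:
  assumes "sq_int M u"
  shows "ennreal ((L2norm M u)\<^sup>2) = (\<integral>\<^sup>+x. (ennreal (cmod (u x)))\<^sup>2 \<partial>M)"
  using assms by (simp add: L2norm_power2 sq_int_def ennreal_power nn_integral_eq_integral)

lemma L2norm_cmult: "L2norm M (\<lambda>x. a * u x) = cmod a * L2norm M u"
  by (simp add: L2norm_def norm_mult power_mult_distrib real_sqrt_mult)

lemma L2norm_minus_commute: "L2norm M (\<lambda>x. u x - v x) = L2norm M (\<lambda>x. v x - u x)"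
  unfolding L2norm_def by (subst norm_minus_commute) (rule refl)

lemma L2inner_self: "L2inner M u u = complex_of_real ((L2norm M u)\<^sup>2)"
  unfolding L2inner_def L2norm_power2 by (simp only: complex_norm_square[symmetric] integral_complex_of_real)

lemma L2inner_cnj: "L2inner M v u = cnj (L2inner M u v)"
  unfolding L2inner_def Bochner_Integration.integral_cnj[symmetric] by (simp add: mult.commute)

lemma L2inner_add_left:
  assumes "sq_int M u" "sq_int M v" "sq_int M w"
  shows "L2inner M (\<lambda>x. u x + v x) w = L2inner M u w + L2inner M v w"
  unfolding L2inner_def distrib_right
  using assms by (intro Bochner_Integration.integral_add sq_int_integrable_mult_cnj)

lemma L2inner_sum_left:
  assumes "\<And>i. i \<in> I \<Longrightarrow> sq_int M (u i)" "sq_int M w"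
  shows "L2inner M (\<lambda>x. \<Sum>i\<in>I. u i x) w = (\<Sum>i\<in>I. L2inner M (u i) w)"
  unfolding L2inner_def sum_distrib_right
  using assms by (intro Bochner_Integration.integral_sum sq_int_integrable_mult_cnj)

lemma L2inner_sum_right:
  assumes "\<And>i. i \<in> I \<Longrightarrow> sq_int M (u i)" "sq_int M w"
  shows "L2inner M w (\<lambda>x. \<Sum>i\<in>I. u i x) = (\<Sum>i\<in>I. L2inner M w (u i))"
  by (subst (1 2) L2inner_cnj) (simp add: L2inner_sum_left[OF assms])

lemma L2_Cauchy_Schwarz_norm:
  assumes "sq_int M u" "sq_int M v"
  shows "(\<integral>x. cmod (u x) * cmod (v x) \<partial>M) \<le> L2norm M u * L2norm M v"
proof -
  have [measurable]: "u \<in> borel_measurable M" "v \<in> borel_measurable M"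
    using assms by (auto simp: sq_int_def)
  have int: "integrable M (\<lambda>x. cmod (u x) * cmod (v x))"
    using integrable_norm[OF sq_int_integrable_mult_cnj[OF assms]] by (simp add: norm_mult)
  have "ennreal ((\<integral>x. cmod (u x) * cmod (v x) \<partial>M)\<^sup>2) =
      (\<integral>\<^sup>+x. ennreal (cmod (u x)) * ennreal (cmod (v x)) \<partial>M)\<^sup>2"
    using nn_integral_eq_integral[OF int] by (simp add: ennreal_mult ennreal_power)
  also have "\<dots> \<le> (\<integral>\<^sup>+x. (ennreal (cmod (u x)))\<^sup>2 \<partial>M) * (\<integral>\<^sup>+x. (ennreal (cmod (v x)))\<^sup>2 \<partial>M)"
    by (rule Cauchy_Schwarz_nn_integral) measurable
  also have "\<dots> = ennreal ((L2norm M u * L2norm M v)\<^sup>2)"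
    using assms by (simp add: ennreal_L2norm_power2[symmetric] ennreal_mult power_mult_distrib)
  finally have "(\<integral>x. cmod (u x) * cmod (v x) \<partial>M)\<^sup>2 \<le> (L2norm M u * L2norm M v)\<^sup>2"
    by simp
  then show ?thesis by (rule power2_le_imp_le) simp
qed

lemma L2_Cauchy_Schwarz:
  assumes "sq_int M u" "sq_int M v"
  shows "cmod (L2inner M u v) \<le> L2norm M u * L2norm M v"
proof -
  have "cmod (L2inner M u v) \<le> (\<integral>x. cmod (u x * cnj (v x)) \<partial>M)"
    unfolding L2inner_def by (rule integral_norm_bound)
  then show ?thesis using L2_Cauchy_Schwarz_norm[OF assms] by (simp add: norm_mult)
qed

lemma L2norm_triangle:
  assumes "sq_int M u" "sq_int M v"
  shows "L2norm M (\<lambda>x. u x + v x) \<le> L2norm M u + L2norm M v"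
proof (rule power2_le_imp_le)
  have uv: "sq_int M (\<lambda>x. u x + v x)" by (rule sq_int_add[OF assms])
  have "complex_of_real ((L2norm M (\<lambda>x. u x + v x))\<^sup>2)
      = L2inner M u u + L2inner M v u + (L2inner M u v + L2inner M v v)"
  proof -
    have "L2inner M w (\<lambda>x. u x + v x) = L2inner M w u + L2inner M w v" if "sq_int M w" for w
      using L2inner_add_left[OF assms that] by (subst (1 2 3) L2inner_cnj) simp
    then show ?thesis
      using assms uv by (simp add: L2inner_self[symmetric] L2inner_add_left del: of_real_power)
  qed
  then have "(L2norm M (\<lambda>x. u x + v x))\<^sup>2
      = Re (L2inner M u u + L2inner M v u + (L2inner M u v + L2inner M v v))"
    by (metis Re_complex_of_real)
  also have "\<dots> = (L2norm M u)\<^sup>2 + (L2norm M v)\<^sup>2 + Re (L2inner M v u) + Re (L2inner M u v)"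
    by (simp add: L2inner_self)
  also have "\<dots> \<le> (L2norm M u + L2norm M v)\<^sup>2"
    using L2_Cauchy_Schwarz[OF assms] L2_Cauchy_Schwarz[OF assms(2,1)]
      complex_Re_le_cmod[of "L2inner M u v"] complex_Re_le_cmod[of "L2inner M v u"]
    unfolding power2_sum mult.commute[of "L2norm M v"] by linarith
  finally show "(L2norm M (\<lambda>x. u x + v x))\<^sup>2 \<le> (L2norm M u + L2norm M v)\<^sup>2" .
qed simp

lemma L2norm_triangle_diff:
  assumes "sq_int M u" "sq_int M v"
  shows "\<bar>L2norm M u - L2norm M v\<bar> \<le> L2norm M (\<lambda>x. u x - v x)"
proof -
  have "L2norm M u \<le> L2norm M (\<lambda>x. u x - v x) + L2norm M v" if "sq_int M u" "sq_int M v" for u v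
    using L2norm_triangle[OF sq_int_diff[OF that] that(2)] by simp
  from this[OF assms] this[OF assms(2,1)] show ?thesis
    using L2norm_minus_commute[of M u v] by linarith
qed

section \<open>Pythagoras and Bessel for finite orthogonal families\<close>

lemma L2norm_sum_orthogonal:
  assumes "finite I" "\<And>i. i \<in> I \<Longrightarrow> sq_int M (u i)"
    and "\<And>i j. i \<in> I \<Longrightarrow> j \<in> I \<Longrightarrow> i \<noteq> j \<Longrightarrow> L2inner M (u i) (u j) = 0"
  shows "(L2norm M (\<lambda>x. \<Sum>i\<in>I. u i x))\<^sup>2 = (\<Sum>i\<in>I. (L2norm M (u i))\<^sup>2)"
proof -
  have "complex_of_real ((L2norm M (\<lambda>x. \<Sum>i\<in>I. u i x))\<^sup>2) = (\<Sum>i\<in>I. \<Sum>j\<in>I. L2inner M (u i) (u j))"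
    using assms(2) by (simp add: L2inner_self[symmetric] L2inner_sum_left L2inner_sum_right sq_int_sum del: of_real_power)
  also have "\<dots> = (\<Sum>i\<in>I. L2inner M (u i) (u i))"
  proof (rule sum.cong[OF refl])
    fix i assume "i \<in> I"
    with assms(1,3) show "(\<Sum>j\<in>I. L2inner M (u i) (u j)) = L2inner M (u i) (u i)"
      by (subst sum.remove[of _ i]) (auto intro!: sum.neutral)
  qed
  also have "\<dots> = complex_of_real (\<Sum>i\<in>I. (L2norm M (u i))\<^sup>2)"
    by (simp add: L2inner_self)
  finally show ?thesis by (simp only: of_real_eq_iff)
qed

text \<open>The last two hypotheses give \<open>(f, s) = (s, s)\<close> for the sum
  \<open>s\<close>, as for an orthogonal projection of \<open>f\<close>. Cauchy-Schwarz then yields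
  the bound, without normalizing the \<open>u i\<close>.\<close>

lemma L2norm_orthogonal_projection_le:
  assumes "finite I" "\<And>i. i \<in> I \<Longrightarrow> sq_int M (u i)" "sq_int M f"
    and "\<And>i j. i \<in> I \<Longrightarrow> j \<in> I \<Longrightarrow> i \<noteq> j \<Longrightarrow> L2inner M (u i) (u j) = 0"
    and "\<And>i. i \<in> I \<Longrightarrow> L2inner M f (u i) = L2inner M (u i) (u i)"
  shows "L2norm M (\<lambda>x. \<Sum>i\<in>I. u i x) \<le> L2norm M f"
proof -
  define s where "s = (\<lambda>x. \<Sum>i\<in>I. u i x)"
  have s: "sq_int M s" unfolding s_def by (rule sq_int_sum) (rule assms(2))
  have "L2inner M f s = (\<Sum>i\<in>I. L2inner M (u i) (u i))"
    unfolding s_def using assms(2,3,5) by (simp add: L2inner_sum_right)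
  also have "\<dots> = complex_of_real ((L2norm M s)\<^sup>2)"
    unfolding s_def using L2norm_sum_orthogonal[OF assms(1,2,4)] by (simp add: L2inner_self flip: of_real_sum of_real_power)
  finally have "(L2norm M s)\<^sup>2 \<le> L2norm M f * L2norm M s"
    using L2_Cauchy_Schwarz[OF assms(3) s] by (simp add: norm_power)
  then have "L2norm M s \<le> L2norm M f"
    by (cases "L2norm M s = 0") (auto simp: power2_eq_square order_less_le)
  then show ?thesis by (simp add: s_def)
qed

section \<open>Completeness of L2\<close>

text \<open>Since the measure is finite, a rapidly convergent subsequence is summable in \<open>L\<^sup>1\<close>, so it
  converges almost everywhere, and Fatou's lemma identifies its limit as the \<open>L\<^sup>2\<close> limit.\<close>

lemma (in prob_space) L2_complete:
  fixes s :: "nat \<Rightarrow> 'a \<Rightarrow> complex"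
  assumes [measurable]: "\<And>n. s n \<in> borel_measurable M"
    and "\<And>e. 0 < e \<Longrightarrow> \<exists>N. \<forall>m\<ge>N. \<forall>n\<ge>N. (\<integral>\<^sup>+x. (ennreal (cmod (s m x - s n x)))\<^sup>2 \<partial>M) \<le> ennreal e"
  shows "\<exists>h\<in>borel_measurable M.
      (\<lambda>n. \<integral>\<^sup>+x. (ennreal (cmod (s n x - h x)))\<^sup>2 \<partial>M) \<longlonglongrightarrow> 0"
proof -
  have "\<forall>k. \<exists>N. \<forall>m\<ge>N. \<forall>n\<ge>N. (\<integral>\<^sup>+x. (ennreal (cmod (s m x - s n x)))\<^sup>2 \<partial>M) \<le> ennreal ((1/4)^k)"
    using assms(2) by simp
  then obtain N0 where N0: "\<And>k m n. N0 k \<le> m \<Longrightarrow> N0 k \<le> n \<Longrightarrow>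
      (\<integral>\<^sup>+x. (ennreal (cmod (s m x - s n x)))\<^sup>2 \<partial>M) \<le> ennreal ((1/4)^k)"
    by metis
  \<comment> \<open>The partial sum makes \<open>N\<close> monotone and at least \<open>N0\<close>;
    the summand \<open>k\<close> makes it unbounded.\<close>
  define N where "N k = k + (\<Sum>i\<le>k. N0 i)" for k
  have N_ge: "N0 k \<le> N k" for k unfolding N_def by (simp add: member_le_sum trans_le_add2)
  have N_mono: "N k \<le> N (Suc k)" for k unfolding N_def by simp
  have N_id: "k \<le> N k" for k unfolding N_def by simp
  define t where "t k = s (N k)" for k
  have [measurable]: "t k \<in> borel_measurable M" for k unfolding t_def by simp
  define d where "d k x = ennreal (cmod (t (Suc k) x - t k x))" for k x
  have [measurable]: "d k \<in> borel_measurable M" for k unfolding d_def by measurable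
  \<comment> \<open>Cauchy-Schwarz against the constant 1 turns the squared L2 bound
    \<open>(1/4)^k\<close> into the summable L1 bound \<open>(1/2)^k\<close>.\<close>
  have d_le: "(\<integral>\<^sup>+x. d k x \<partial>M) \<le> ennreal ((1/2)^k)" for k
  proof -
    have "(\<integral>\<^sup>+x. d k x * 1 \<partial>M)\<^sup>2 \<le> (\<integral>\<^sup>+x. (d k x)\<^sup>2 \<partial>M) * (\<integral>\<^sup>+x. 1\<^sup>2 \<partial>M)"
      by (rule Cauchy_Schwarz_nn_integral) measurable
    also have "\<dots> \<le> ennreal ((1/4)^k)"
      using N0[of k "N (Suc k)" "N k"] N_ge[of k] N_mono[of k]
      by (simp add: d_def t_def emeasure_space_1)
    also have "\<dots> = (ennreal ((1/2)^k))\<^sup>2"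
      by (simp add: ennreal_power power2_eq_square flip: power_mult_distrib ennreal_mult)
    finally show ?thesis by (intro ennreal_power2_le_imp_le) simp_all
  qed
  have "(\<integral>\<^sup>+x. (\<Sum>k. d k x) \<partial>M) = (\<Sum>k. \<integral>\<^sup>+x. d k x \<partial>M)"
    by (rule nn_integral_suminf) measurable
  also have "\<dots> \<le> (\<Sum>k. ennreal ((1/2)^k))"
    by (intro suminf_le d_le) auto
  also have "\<dots> < \<infinity>"
    by (subst suminf_ennreal2) (auto simp: summable_geometric)
  finally have "AE x in M. (\<Sum>k. d k x) \<noteq> \<infinity>"
    by (intro nn_integral_PInf_AE) auto
  then have conv: "AE x in M. convergent (\<lambda>k. t k x)"
  proof eventually_elim
    case (elim x)
    have "summable (\<lambda>k. cmod (t (Suc k) x - t k x))"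
      using elim unfolding d_def by (intro summable_suminf_not_top) auto
    then have "summable (\<lambda>k. t (Suc k) x - t k x)" by (rule summable_norm_cancel)
    then have "convergent (\<lambda>n. \<Sum>k<n. t (Suc k) x - t k x)" by (simp add: summable_iff_convergent)
    then have "convergent (\<lambda>n. t n x - t 0 x)"
      by (simp add: sum_lessThan_telescope[where f = "\<lambda>k. t k x"])
    from convergent_add[OF this convergent_const[of "t 0 x"]] show ?case by simp
  qed
  define h where "h x = lim (\<lambda>k. t k x)" for x
  have [measurable]: "h \<in> borel_measurable M" unfolding h_def by measurable
  have lim: "AE x in M. (\<lambda>k. t k x) \<longlonglongrightarrow> h x"
    using conv unfolding h_def by (simp add: convergent_LIMSEQ_iff)
  \<comment> \<open>This covers every \<open>n\<close>, not only the subsequence: \<open>s n\<close>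
    is compared with \<open>t k\<close> for large \<open>k\<close>, and \<open>k \<le> N k\<close>
    brings \<open>t k\<close> into the range of the Cauchy condition.\<close>
  have bound: "(\<integral>\<^sup>+x. (ennreal (cmod (s n x - h x)))\<^sup>2 \<partial>M) \<le> ennreal e"
    if "\<forall>m\<ge>N1. (\<integral>\<^sup>+x. (ennreal (cmod (s n x - s m x)))\<^sup>2 \<partial>M) \<le> ennreal e" for n N1 e
  proof -
    have "(\<integral>\<^sup>+x. (ennreal (cmod (s n x - h x)))\<^sup>2 \<partial>M)
        = (\<integral>\<^sup>+x. liminf (\<lambda>k. (ennreal (cmod (s n x - t k x)))\<^sup>2) \<partial>M)"
    proof (rule nn_integral_cong_AE)
      show "AE x in M. (ennreal (cmod (s n x - h x)))\<^sup>2 = liminf (\<lambda>k. (ennreal (cmod (s n x - t k x)))\<^sup>2)"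
        using lim
      proof eventually_elim
        case (elim x)
        have "(\<lambda>k. ennreal ((cmod (s n x - t k x))\<^sup>2)) \<longlonglongrightarrow> ennreal ((cmod (s n x - h x))\<^sup>2)"
          using elim by (intro tendsto_intros)
        from lim_imp_Liminf[OF _ this] show ?case by (simp add: ennreal_power)
      qed
    qed
    also have "\<dots> \<le> liminf (\<lambda>k. \<integral>\<^sup>+x. (ennreal (cmod (s n x - t k x)))\<^sup>2 \<partial>M)"
      by (rule nn_integral_liminf) measurable
    also have "\<dots> \<le> limsup (\<lambda>k. \<integral>\<^sup>+x. (ennreal (cmod (s n x - t k x)))\<^sup>2 \<partial>M)"
      by (rule Liminf_le_Limsup) simp
    also have "\<dots> \<le> ennreal e"
    proof (intro Limsup_bounded eventually_sequentiallyI[of N1])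
      fix k assume "N1 \<le> k"
      then have "N1 \<le> N k" using N_id[of k] by linarith
      with that show "(\<integral>\<^sup>+x. (ennreal (cmod (s n x - t k x)))\<^sup>2 \<partial>M) \<le> ennreal e"
        unfolding t_def by blast
    qed
    finally show ?thesis .
  qed
  have "(\<lambda>n. \<integral>\<^sup>+x. (ennreal (cmod (s n x - h x)))\<^sup>2 \<partial>M) \<longlonglongrightarrow> 0"
  proof (rule order_tendstoI)
    fix a :: ennreal assume "0 < a"
    then obtain b where b: "0 < b" "b < a" using dense by blast
    then obtain e where "b = ennreal e" by (cases b) auto
    with b have e: "0 < e" "ennreal e < a" by auto
    obtain N1 where "\<forall>m\<ge>N1. \<forall>n\<ge>N1. (\<integral>\<^sup>+x. (ennreal (cmod (s m x - s n x)))\<^sup>2 \<partial>M) \<le> ennreal e"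
      using assms(2) e(1) by blast
    then show "\<forall>\<^sub>F n in sequentially. (\<integral>\<^sup>+x. (ennreal (cmod (s n x - h x)))\<^sup>2 \<partial>M) < a"
      using e(2) by (intro eventually_sequentiallyI[of N1] le_less_trans[OF bound]) blast+
  qed auto
  then show ?thesis by (intro bexI[of _ h]) auto
qed

text \<open>\<open>L2_complete\<close> speaks of non-negative integrals, which make sense before the
  limit is known to be square integrable. Here that is shown, and the convergence is restated for
  \<open>L2norm\<close>.\<close>

lemma L2_limit_exists:
  assumes "prob_space M" "\<And>n. sq_int M (s n)"
    and "\<And>e. 0 < e \<Longrightarrow> \<exists>N. \<forall>m\<ge>N. \<forall>n\<ge>N. (L2norm M (\<lambda>x. s m x - s n x))\<^sup>2 \<le> e"
  shows "\<exists>h. sq_int M h \<and> (\<lambda>n. L2norm M (\<lambda>x. s n x - h x)) \<longlonglongrightarrow> 0"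
proof -
  interpret prob_space M by fact
  have [measurable]: "s n \<in> borel_measurable M" for n using assms(2) by (simp add: sq_int_def)
  have "\<exists>h\<in>borel_measurable M. (\<lambda>n. \<integral>\<^sup>+x. (ennreal (cmod (s n x - h x)))\<^sup>2 \<partial>M) \<longlonglongrightarrow> 0"
  proof (rule L2_complete)
    fix e :: real assume "0 < e"
    then obtain N where "\<forall>m\<ge>N. \<forall>n\<ge>N. (L2norm M (\<lambda>x. s m x - s n x))\<^sup>2 \<le> e" using assms(3) by blast
    then show "\<exists>N. \<forall>m\<ge>N. \<forall>n\<ge>N. (\<integral>\<^sup>+x. (ennreal (cmod (s m x - s n x)))\<^sup>2 \<partial>M) \<le> ennreal e"
      by (intro exI[of _ N])
        (auto simp: ennreal_L2norm_power2[symmetric] sq_int_diff assms(2) intro!: ennreal_leI)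
  qed simp
  then obtain h where [measurable]: "h \<in> borel_measurable M"
    and h: "(\<lambda>n. \<integral>\<^sup>+x. (ennreal (cmod (s n x - h x)))\<^sup>2 \<partial>M) \<longlonglongrightarrow> 0" by blast
  \<comment> \<open>The value 1 only ensures finiteness: once \<open>s n - h\<close> is square
    integrable for one \<open>n\<close>, so is \<open>h = s n - (s n - h)\<close>.\<close>
  have "\<forall>\<^sub>F n in sequentially. (\<integral>\<^sup>+x. (ennreal (cmod (s n x - h x)))\<^sup>2 \<partial>M) < 1"
    using h by (rule order_tendstoD) simp
  then obtain n0 where n0: "\<And>n. n \<ge> n0 \<Longrightarrow> (\<integral>\<^sup>+x. (ennreal (cmod (s n x - h x)))\<^sup>2 \<partial>M) < 1"
    by (auto simp: eventually_sequentially)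
  have sqd: "sq_int M (\<lambda>x. s n x - h x)" if "n \<ge> n0" for n
  proof -
    have "(\<integral>\<^sup>+x. ennreal ((cmod (s n x - h x))\<^sup>2) \<partial>M) < \<infinity>"
      using n0[OF that] by (simp add: ennreal_power) (metis ennreal_one_less_top order_less_trans)
    then show ?thesis by (simp add: sq_int_def integrable_iff_bounded)
  qed
  have sqh: "sq_int M h"
    using sq_int_diff[OF assms(2) sqd[OF order_refl], of n0] by simp
  have "(\<lambda>n. ennreal ((L2norm M (\<lambda>x. s n x - h x))\<^sup>2)) \<longlonglongrightarrow> ennreal 0"
    using h sq_int_diff[OF assms(2) sqh] by (simp add: ennreal_L2norm_power2)
  then have "(\<lambda>n. (L2norm M (\<lambda>x. s n x - h x))\<^sup>2) \<longlonglongrightarrow> 0"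
    by (subst (asm) tendsto_ennreal_iff) auto
  then have "(\<lambda>n. sqrt ((L2norm M (\<lambda>x. s n x - h x))\<^sup>2)) \<longlonglongrightarrow> sqrt 0"
    by (rule tendsto_real_sqrt)
  with sqh show ?thesis by auto
qed

section \<open>Dyadic cubes and martingale differences\<close>

lemma finite_vec_Pi:
  fixes S :: "'n::finite \<Rightarrow> 'a set"
  assumes "\<And>i. finite (S i)"
  shows "finite {j::'a^'n. \<forall>i. j$i \<in> S i}"
proof (rule finite_subset)
  show "{j::'a^'n. \<forall>i. j$i \<in> S i} \<subseteq> vec_lambda ` (\<Pi>\<^sub>E i\<in>UNIV. S i)"
  proof
    fix j :: "'a^'n" assume "j \<in> {j. \<forall>i. j$i \<in> S i}"
    then have "vec_nth j \<in> (\<Pi>\<^sub>E i\<in>UNIV. S i)" by auto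
    then show "j \<in> vec_lambda ` (\<Pi>\<^sub>E i\<in>UNIV. S i)" by (metis image_eqI vec_nth_inverse)
  qed
  show "finite (vec_lambda ` (\<Pi>\<^sub>E i\<in>UNIV. S i) :: ('a^'n) set)"
    using assms by (intro finite_imageI finite_PiE) auto
qed

lemma finite_children [simp]: "finite (children j)"
  using finite_vec_Pi[of "\<lambda>i. {2 * j$i, 2 * j$i + 1}"] by (simp add: children_def)

lemma finite_idx [simp]: "finite (idx k)"
  using finite_vec_Pi[of "\<lambda>i. {0..<(2::int)^k}"] by (simp add: idx_def)

lemma side_pos [simp]: "0 < side k"
  by (simp add: side_def)

lemma side_Suc: "side (Suc k) = side k / 2"
  by (simp add: side_def)

text \<open>The index of the generation-\<open>k\<close> cube of \<open>D(\<omega>)\<close> containing a given point; points outside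
  \<open>\<omega> + Q\<^sub>*\<close> get indices outside \<open>idx k\<close>.\<close>

definition cube_index :: "real^'n \<Rightarrow> real^'n \<Rightarrow> nat \<Rightarrow> real^'n \<Rightarrow> int^'n" where
  "cube_index c \<omega> k x = (\<chi> i. \<lfloor>(x$i - \<omega>$i - c$i) * 2^k\<rfloor>)"

text \<open>Half-open cubes are level sets of a floor function. Disjointness, covering and nesting
  of dyadic cubes thereby become integer arithmetic.\<close>

lemma mem_dcube_iff: "x \<in> dcube c \<omega> k j \<longleftrightarrow> cube_index c \<omega> k x = j"
proof -
  have "\<lfloor>(x$i - \<omega>$i - c$i) * 2^k\<rfloor> = j$i \<longleftrightarrow>
      \<omega>$i + c$i + side k * of_int (j$i) \<le> x$i \<and> x$i < \<omega>$i + c$i + side k * of_int (j$i) + side k" for i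
    by (auto simp: floor_eq_iff side_def field_simps)
  then show ?thesis
    by (simp add: dcube_def cube_def dcorner_def cube_index_def vec_eq_iff)
qed

text \<open>Halving commutes with the floor in the form
  \<open>floor (y / 2) = floor y div 2\<close>, for negative \<open>y\<close> too, so points outside
  the shifted unit cube are covered.\<close>

lemma cube_index_Suc: "cube_index c \<omega> k x $ i = cube_index c \<omega> (Suc k) x $ i div 2"
proof -
  have "(x$i - \<omega>$i - c$i) * 2^k = (x$i - \<omega>$i - c$i) * 2^Suc k / of_int 2" by simp
  then show ?thesis
    unfolding cube_index_def using floor_divide_real_eq_div[of 2 "(x$i - \<omega>$i - c$i) * 2^Suc k"] by simp
qed

lemma cube_index_mono:
  assumes "k \<le> l" "cube_index c \<omega> l x = cube_index c \<omega> l y"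
  shows "cube_index c \<omega> k x = cube_index c \<omega> k y"
  using assms
proof (induction rule: inc_induct)
  case (step n)
  then have "cube_index c \<omega> (Suc n) x = cube_index c \<omega> (Suc n) y" by blast
  then show ?case by (simp add: vec_eq_iff[of "cube_index c \<omega> n _"] cube_index_Suc[of c \<omega> n])
qed

lemma children_iff: "j' \<in> children j \<longleftrightarrow> (\<forall>i. j'$i div 2 = j$i)"
proof -
  have "a = 2 * b \<or> a = 2 * b + 1 \<longleftrightarrow> a div 2 = b" for a b :: int by presburger
  then show ?thesis by (simp add: children_def)
qed

lemma cube_index_children: "cube_index c \<omega> (Suc k) x \<in> children j \<longleftrightarrow> cube_index c \<omega> k x = j"
  by (simp add: children_iff vec_eq_iff cube_index_Suc[of c \<omega> k x])

lemma dcube_Suc_subset: "dcube c \<omega> (Suc k) (cube_index c \<omega> (Suc k) x) \<subseteq> dcube c \<omega> k (cube_index c \<omega> k x)"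
  by (auto simp: mem_dcube_iff intro: cube_index_mono[OF le_SucI[OF order_refl]])

text \<open>In each coordinate the centre of a child is \<open>side k / 4\<close> away from that of
  its parent, and the doubled child has half-side \<open>side k / 2\<close>; the total stays below
  the half-side \<open>side k\<close> of the doubled parent.\<close>

lemma dbl_dcube_Suc_subset:
  assumes "j' \<in> children j"
  shows "dbl_dcube c \<omega> (Suc k) j' \<subseteq> dbl_dcube c \<omega> k j"
proof
  fix y assume y: "y \<in> dbl_dcube c \<omega> (Suc k) j'"
  show "y \<in> dbl_dcube c \<omega> k j"
    unfolding dbl_dcube_def cube_def
  proof (intro CollectI allI)
    fix i
    have s: "0 < side k" by simp
    have "j'$i = 2 * j$i \<or> j'$i = 2 * j$i + 1" using assms by (simp add: children_def)
    then have "side k / 2 * of_int (j'$i) = side k * of_int (j$i) \<or>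
        side k / 2 * of_int (j'$i) = side k * of_int (j$i) + side k / 2"
      by (auto simp: algebra_simps)
    moreover from y have "\<omega>$i + c$i + side k / 2 * of_int (j'$i) - side k / 4 \<le> y$i \<and>
        y$i < \<omega>$i + c$i + side k / 2 * of_int (j'$i) - side k / 4 + side k"
      by (simp add: dbl_dcube_def cube_def dcorner_def side_Suc)
    ultimately have "\<omega>$i + c$i + side k * of_int (j$i) - side k / 2 \<le> y$i \<and>
        y$i < \<omega>$i + c$i + side k * of_int (j$i) - side k / 2 + 2 * side k"
      using s by linarith
    then show "(dcorner c \<omega> k j - (\<chi> i. side k / 2)) $ i \<le> y $ i \<and>
        y $ i < (dcorner c \<omega> k j - (\<chi> i. side k / 2)) $ i + 2 * side k"
      by (simp add: dcorner_def)
  qed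
qed

text \<open>The half-open children are disjoint and cover their parent, so the definite description
  in \<open>Delta\<close> names the child with index \<open>cube_index\<close> at
  \<open>x\<close>.\<close>

lemma Delta_eq:
  "Delta c M H \<omega> k j \<phi> x =
    (if cube_index c \<omega> k x \<noteq> j then 0
     else if transit c M H \<omega> (Suc k) (cube_index c \<omega> (Suc k) x)
     then avg M (dcube c \<omega> (Suc k) (cube_index c \<omega> (Suc k) x)) \<phi> - avg M (dcube c \<omega> k j) \<phi>
     else \<phi> x - avg M (dcube c \<omega> k j) \<phi>)"
proof (cases "cube_index c \<omega> k x = j")
  case True
  then have "(THE j'. j' \<in> children j \<and> x \<in> dcube c \<omega> (Suc k) j') = cube_index c \<omega> (Suc k) x"
    by (intro the_equality) (auto simp: mem_dcube_iff cube_index_children)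
  with True show ?thesis by (simp add: Delta_def mem_dcube_iff)
qed (simp add: Delta_def mem_dcube_iff)

lemma sum_children_indicator:
  fixes g :: "int^'n \<Rightarrow> 'b::real_vector"
  shows "(\<Sum>j'\<in>children j. indicator (dcube c \<omega> (Suc k) j') x *\<^sub>R g j')
    = (if cube_index c \<omega> k x = j then g (cube_index c \<omega> (Suc k) x) else 0)"
proof -
  have "(\<Sum>j'\<in>children j. indicator (dcube c \<omega> (Suc k) j') x *\<^sub>R g j')
      = (\<Sum>j'\<in>children j. if cube_index c \<omega> (Suc k) x = j' then g j' else 0)"
    by (intro sum.cong) (auto simp: indicator_def mem_dcube_iff)
  then show ?thesis by (simp add: cube_index_children)
qed

text \<open>\<open>Delta_eq\<close> serves pointwise arguments; this finite sum of indicators serves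
  integration and measurability.\<close>

lemma Delta_sum:
  "Delta c M H \<omega> k j \<phi> x =
    (\<Sum>j'\<in>children j. indicator (dcube c \<omega> (Suc k) j') x *\<^sub>R
       (if transit c M H \<omega> (Suc k) j' then avg M (dcube c \<omega> (Suc k) j') \<phi> else \<phi> x))
    - indicator (dcube c \<omega> k j) x *\<^sub>R avg M (dcube c \<omega> k j) \<phi>"
  unfolding Delta_eq sum_children_indicator by (simp add: indicator_def mem_dcube_iff)

section \<open>Mean zero and orthogonality of the martingale differences\<close>

locale haar_system = prob_space M for M :: "(real^'n) measure" +
  fixes c :: "real^'n" and H :: "(real^'n) set"
  assumes sets_M [measurable_cong]: "sets M = sets borel"
begin

abbreviation "Q \<equiv> dcube c"
abbreviation "tr \<equiv> transit c M H"
abbreviation "D \<equiv> Delta c M H"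

lemma measurable_vec_nth [measurable]: "(\<lambda>x::real^'n. x $ i) \<in> borel_measurable borel"
  by (intro borel_measurable_continuous_onI continuous_intros)

text \<open>Joint measurability in shift and point is what integration in both variables requires; a
  fixed shift is a slice of it.\<close>

lemma sets_dcube_pair:
  "{p. snd p \<in> Q (fst p) k j} \<in> sets (borel \<Otimes>\<^sub>M borel)"
proof -
  have "{p :: (real^'n) \<times> (real^'n). real_of_int (j$i) \<le> (snd p$i - fst p$i - c$i) * 2^k \<and>
      (snd p$i - fst p$i - c$i) * 2^k < real_of_int (j$i) + 1} \<in> sets (borel \<Otimes>\<^sub>M borel)" (is "?S i \<in> _") for i
  proof -
    have "{p \<in> space (borel \<Otimes>\<^sub>M borel). real_of_int (j$i) \<le> (snd p$i - fst p$i - c$i) * 2^k \<and>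
      (snd p$i - fst p$i - c$i) * 2^k < real_of_int (j$i) + 1} \<in> sets (borel \<Otimes>\<^sub>M (borel :: (real^'n) measure))"
      by measurable
    then show ?thesis by (simp add: space_pair_measure)
  qed
  then have "(\<Inter>i. ?S i) \<in> sets (borel \<Otimes>\<^sub>M borel)"
    by (intro sets.finite_INT) auto
  moreover have "{p. snd p \<in> Q (fst p) k j} = (\<Inter>i. ?S i)"
    by (auto simp: mem_dcube_iff cube_index_def vec_eq_iff floor_eq_iff)
  ultimately show ?thesis by simp
qed

lemma sets_dcube [measurable]: "Q w k j \<in> sets M"
proof -
  have "(\<lambda>x. (w, x)) -` {p. snd p \<in> Q (fst p) k j} \<inter> space borel \<in> sets borel"
    by (rule measurable_sets[OF _ sets_dcube_pair]) simp
  then show ?thesis by (simp add: sets_M)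
qed

text \<open>Both ways of being terminal pass from a cube to its children: measure zero by
  monotonicity, and \<open>2Q\<close> inside \<open>H\<close> because doubled cubes nest. Hence
  ancestors of transit cubes are transit.\<close>

lemma transit_mono:
  assumes "k \<le> l" "tr w l (cube_index c w l x)"
  shows "tr w k (cube_index c w k x)"
  using assms
proof (induction rule: inc_induct)
  case (step n)
  have "measure M (Q w (Suc n) (cube_index c w (Suc n) x)) \<le> measure M (Q w n (cube_index c w n x))"
    by (intro finite_measure_mono dcube_Suc_subset) measurable
  moreover have "dbl_dcube c w (Suc n) (cube_index c w (Suc n) x) \<subseteq> dbl_dcube c w n (cube_index c w n x)"
    by (intro dbl_dcube_Suc_subset) (simp add: cube_index_children)
  ultimately show ?case
    using step.IH[OF step.prems] measure_nonneg[of M]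
    by (auto simp: transit_def terminal_def order.antisym)
qed simp

text \<open>A transit cube has non-zero measure, so the division in \<open>avg\<close> is
  genuine.\<close>

lemma avg_mult_measure:
  assumes "tr w k j"
  shows "avg M (Q w k j) \<phi> * complex_of_real (measure M (Q w k j)) = (\<integral>x. indicator (Q w k j) x *\<^sub>R \<phi> x \<partial>M)"
  using assms by (simp add: avg_def transit_def terminal_def)

lemma sq_int_indicator_scaleR:
  assumes "sq_int M u" "A \<in> sets M"
  shows "sq_int M (\<lambda>x. indicator A x *\<^sub>R u x)"
proof -
  have "indicator A x *\<^sub>R u x = indicator A x * u x" for x
    by (cases "x \<in> A") auto
  then show ?thesis using sq_int_indicator[OF assms] by simp
qed

lemma sq_int_const: "sq_int M (\<lambda>x. a)"
  by (rule sq_int_bounded[OF finite_measure_axioms, of _ "cmod a"]) auto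

lemma sq_int_Delta:
  assumes "sq_int M f"
  shows "sq_int M (D w k j f)"
proof -
  have "sq_int M (\<lambda>x. if P then a else f x)" for P a
    using assms sq_int_const by (cases P) auto
  then have "sq_int M (\<lambda>x. (\<Sum>j'\<in>children j. indicator (Q w (Suc k) j') x *\<^sub>R
       (if tr w (Suc k) j' then avg M (Q w (Suc k) j') f else f x))
    - indicator (Q w k j) x *\<^sub>R avg M (Q w k j) f)"
    by (intro sq_int_diff sq_int_sum sq_int_indicator_scaleR sq_int_const sets_dcube)
  then show ?thesis by (simp add: Delta_sum[abs_def])
qed

text \<open>On a transit child \<open>f\<close> is replaced by its average and on a terminal child
  it is kept, so its integral over each child is unchanged. Summed over the children this is the
  integral over the parent, which the subtracted average cancels.\<close>

lemma integral_Delta: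
  assumes f: "sq_int M f" and t: "tr w k j"
  shows "(\<integral>x. D w k j f x \<partial>M) = 0"
proof -
  have int_f: "integrable M f" by (rule sq_int_integrable[OF finite_measure_axioms f])
  let ?g = "\<lambda>j' x. if tr w (Suc k) j' then avg M (Q w (Suc k) j') f else f x"
  have g: "integrable M (\<lambda>x. indicator (Q w (Suc k) j') x *\<^sub>R ?g j' x)" for j'
    using int_f by (cases "tr w (Suc k) j'") (auto intro!: integrable_mult_indicator)
  have "(\<integral>x. D w k j f x \<partial>M) = (\<Sum>j'\<in>children j. \<integral>x. indicator (Q w (Suc k) j') x *\<^sub>R ?g j' x \<partial>M)
      - (\<integral>x. indicator (Q w k j) x *\<^sub>R avg M (Q w k j) f \<partial>M)"
    unfolding Delta_sum
    by (simp only: Bochner_Integration.integral_diff Bochner_Integration.integrable_sum Bochner_Integration.integral_sum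
        g integrable_mult_indicator sets_dcube integrable_const)
  also have "(\<integral>x. indicator (Q w k j) x *\<^sub>R avg M (Q w k j) f \<partial>M) = (\<integral>x. indicator (Q w k j) x *\<^sub>R f x \<partial>M)"
    using avg_mult_measure[OF t, of f] by (simp add: scaleR_conv_of_real mult.commute)
  also have "(\<Sum>j'\<in>children j. \<integral>x. indicator (Q w (Suc k) j') x *\<^sub>R ?g j' x \<partial>M)
      = (\<Sum>j'\<in>children j. \<integral>x. indicator (Q w (Suc k) j') x *\<^sub>R f x \<partial>M)"
  proof (rule sum.cong[OF refl])
    fix j'
    show "(\<integral>x. indicator (Q w (Suc k) j') x *\<^sub>R ?g j' x \<partial>M) = (\<integral>x. indicator (Q w (Suc k) j') x *\<^sub>R f x \<partial>M)"
      using avg_mult_measure[of w "Suc k" j' f]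
      by (cases "tr w (Suc k) j'") (simp_all add: scaleR_conv_of_real mult.commute)
  qed
  also have "\<dots> = (\<integral>x. (\<Sum>j'\<in>children j. indicator (Q w (Suc k) j') x *\<^sub>R f x) \<partial>M)"
    by (intro Bochner_Integration.integral_sum[symmetric] integrable_mult_indicator sets_dcube int_f)
  also have "\<dots> = (\<integral>x. indicator (Q w k j) x *\<^sub>R f x \<partial>M)"
    unfolding sum_children_indicator by (intro Bochner_Integration.integral_cong) (auto simp: indicator_def mem_dcube_iff)
  finally show ?thesis by simp
qed

text \<open>The coarser difference is constant on the finer transit cube, over which the finer
  difference has mean zero.\<close>

lemma Delta_orthogonal_less:
  assumes f: "sq_int M f" and t: "tr w l i" and "k < l"
  shows "L2inner M (D w k j f) (D w l i f) = 0"
proof (cases "\<exists>x. cube_index c w l x = i")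
  case False
  then have "D w l i f = (\<lambda>x. 0)" by (auto simp: Delta_eq)
  then show ?thesis by (simp add: L2inner_def)
next
  case True
  then obtain y where y: "cube_index c w l y = i" by blast
  have *: "D w k j f x * cnj (D w l i f x) = D w k j f y * cnj (D w l i f x)" for x
  proof (cases "cube_index c w l x = i")
    case True
    have eq: "cube_index c w k x = cube_index c w k y" "cube_index c w (Suc k) x = cube_index c w (Suc k) y"
      using cube_index_mono[of _ l c w x y] True y \<open>k < l\<close> by auto
    \<comment> \<open>On a terminal child the coarser difference would follow \<open>f\<close>
      itself; the transit property of the finer cube excludes this.\<close>
    have "tr w (Suc k) (cube_index c w (Suc k) y)"
      using transit_mono[of "Suc k" l w y] t y \<open>k < l\<close> by simp
    then have "D w k j f x = D w k j f y" by (simp add: Delta_eq eq)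
    then show ?thesis by simp
  qed (simp add: Delta_eq)
  have "L2inner M (D w k j f) (D w l i f) = D w k j f y * cnj (\<integral>x. D w l i f x \<partial>M)"
    unfolding L2inner_def * by simp
  then show ?thesis by (simp add: integral_Delta[OF f t])
qed

text \<open>Distinct generations reduce to the previous lemma, up to conjugation; distinct cubes of
  one generation are disjoint.\<close>

lemma Delta_orthogonal:
  assumes f: "sq_int M f" and "tr w k j" "tr w l i" and "(k, j) \<noteq> (l, i)"
  shows "L2inner M (D w k j f) (D w l i f) = 0"
proof (cases k l rule: linorder_cases)
  case less
  then show ?thesis using assms Delta_orthogonal_less by blast
next
  case greater
  then show ?thesis
    using Delta_orthogonal_less[OF f assms(2) greater, of i] by (subst L2inner_cnj) simp
next
  case equal
  then have *: "D w k j f x * cnj (D w l i f x) = 0" for x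
    using assms(4) by (auto simp: Delta_eq)
  show ?thesis unfolding L2inner_def * by simp
qed

text \<open>On the cube, \<open>f\<close> minus its difference is the constant \<open>a\<close> on
  terminal children and \<open>a + (f - b)\<close> on transit ones. The constant is orthogonal to
  the mean-zero difference. On a transit child the difference is the constant \<open>b - a\<close>,
  while \<open>f - b\<close> has mean zero there; the functions \<open>T\<close> collect these
  products.\<close>

lemma L2inner_Delta_self:
  assumes f: "sq_int M f" and t: "tr w k j"
  shows "L2inner M f (D w k j f) = L2inner M (D w k j f) (D w k j f)"
proof -
  have int_f: "integrable M f" by (rule sq_int_integrable[OF finite_measure_axioms f])
  define a where "a = avg M (Q w k j) f"
  define b where "b j' = avg M (Q w (Suc k) j') f" for j'
  define T where "T j' x = indicator (Q w (Suc k) j') x *\<^sub>R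
    (if tr w (Suc k) j' then (f x - b j') * cnj (b j' - a) else 0)" for j' x
  have T_alt: "T j' x = (if tr w (Suc k) j' then
      (indicator (Q w (Suc k) j') x *\<^sub>R f x - indicator (Q w (Suc k) j') x *\<^sub>R b j') * cnj (b j' - a) else 0)" for j' x
    by (simp add: T_def scaleR_diff_right[symmetric])
  have sqD: "sq_int M (D w k j f)" by (rule sq_int_Delta[OF f])
  have intD: "integrable M (D w k j f)" by (rule sq_int_integrable[OF finite_measure_axioms sqD])
  have intT: "integrable M (T j')" for j'
    unfolding T_alt[abs_def] using int_f
    by (cases "tr w (Suc k) j'")
      (auto intro!: integrable_mult_left Bochner_Integration.integrable_diff integrable_mult_indicator)
  have T0: "(\<integral>x. T j' x \<partial>M) = 0" for j'
  proof (cases "tr w (Suc k) j'")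
    case True
    have "(\<integral>x. indicator (Q w (Suc k) j') x *\<^sub>R f x - indicator (Q w (Suc k) j') x *\<^sub>R b j' \<partial>M) = 0"
    proof (subst Bochner_Integration.integral_diff)
      show "(\<integral>x. indicator (Q w (Suc k) j') x *\<^sub>R f x \<partial>M) - (\<integral>x. indicator (Q w (Suc k) j') x *\<^sub>R b j' \<partial>M) = 0"
        using avg_mult_measure[OF True, of f] by (simp add: b_def scaleR_conv_of_real mult.commute)
    qed (intro integrable_mult_indicator sets_dcube int_f integrable_const)+
    then show ?thesis unfolding T_alt using True by simp
  qed (simp add: T_def)
  have "f x * cnj (D w k j f x)
      = D w k j f x * cnj (D w k j f x) + a * cnj (D w k j f x) + (\<Sum>j'\<in>children j. T j' x)" for x
    unfolding T_def sum_children_indicator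
    by (simp add: Delta_eq a_def b_def algebra_simps)
  then have "L2inner M f (D w k j f) = (\<integral>x. D w k j f x * cnj (D w k j f x) + a * cnj (D w k j f x)
      + (\<Sum>j'\<in>children j. T j' x) \<partial>M)"
    by (simp add: L2inner_def)
  also have "\<dots> = L2inner M (D w k j f) (D w k j f) + a * cnj (\<integral>x. D w k j f x \<partial>M) + (\<Sum>j'\<in>children j. \<integral>x. T j' x \<partial>M)"
    using sq_int_integrable_mult_cnj[OF sqD sqD] intD intT
    by (simp add: L2inner_def)
  finally show ?thesis by (simp add: T0 integral_Delta[OF f t])
qed

section \<open>Haar series and their energies by generation\<close>

definition gen_energy :: "(nat \<Rightarrow> int^'n \<Rightarrow> bool) \<Rightarrow> (real^'n \<Rightarrow> complex) \<Rightarrow> real^'n \<Rightarrow> nat \<Rightarrow> real" where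
  "gen_energy P f w k = (\<Sum>j\<in>{j\<in>idx k. tr w k j \<and> P k j}. (L2norm M (D w k j f))\<^sup>2)"

lemma gen_energy_nonneg: "0 \<le> gen_energy P f w k"
  by (simp add: gen_energy_def sum_nonneg)

text \<open>An arbitrary finite set of generations covers both the partial sums
  (\<open>{..<N}\<close>) and their differences (\<open>{n..<m}\<close>).\<close>

lemma L2norm_haar_sum:
  assumes f: "sq_int M f" and "finite A"
  shows "(L2norm M (\<lambda>x. \<Sum>k\<in>A. \<Sum>j\<in>{j\<in>idx k. tr w k j \<and> P k j}. D w k j f x))\<^sup>2 = (\<Sum>k\<in>A. gen_energy P f w k)"
proof -
  let ?S = "SIGMA k:A. {j\<in>idx k. tr w k j \<and> P k j}"
  have "(L2norm M (\<lambda>x. \<Sum>q\<in>?S. D w (fst q) (snd q) f x))\<^sup>2 = (\<Sum>q\<in>?S. (L2norm M (D w (fst q) (snd q) f))\<^sup>2)"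
    using assms by (intro L2norm_sum_orthogonal finite_SigmaI) (auto intro!: sq_int_Delta Delta_orthogonal)
  then show ?thesis
    using \<open>finite A\<close> by (simp add: gen_energy_def sum.Sigma split_beta)
qed

text \<open>Constants are orthogonal to mean-zero functions, so the mean of \<open>f\<close> joins
  the orthogonal family as one more member, indexed by \<open>None\<close>.\<close>

lemma L2norm_Lam_add_haar_psum:
  assumes f: "sq_int M f"
  shows "L2norm M (\<lambda>x. Lam M f + haar_psum c M H w P f N x) \<le> L2norm M f"
proof -
  let ?S = "SIGMA k:{..<N}. {j\<in>idx k. tr w k j \<and> P k j}"
  define u where "u q = (case q of None \<Rightarrow> \<lambda>x. Lam M f | Some (k, j) \<Rightarrow> D w k j f)" for q
  let ?I = "insert None (Some ` ?S)"
  have fin: "finite ?S" by (intro finite_SigmaI) auto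
  have sq: "sq_int M (u q)" for q
    by (auto simp: u_def sq_int_const sq_int_Delta f split: option.split)
  have const: "L2inner M (D w k j f) (\<lambda>x. a) = 0" "L2inner M (\<lambda>x. a) (D w k j f) = 0" if "tr w k j" for k j a
    using integral_Delta[OF f that] by (simp_all add: L2inner_def)
  have "(\<lambda>x. Lam M f + haar_psum c M H w P f N x) = (\<lambda>x. \<Sum>q\<in>?I. u q x)"
    using fin by (auto simp: fun_eq_iff haar_psum_def u_def sum.reindex sum.Sigma split_beta)
  moreover have "L2norm M (\<lambda>x. \<Sum>q\<in>?I. u q x) \<le> L2norm M f"
  proof (rule L2norm_orthogonal_projection_le)
    show "L2inner M (u p) (u q) = 0" if "p \<in> ?I" "q \<in> ?I" "p \<noteq> q" for p q
      using that const by (auto simp: u_def intro!: Delta_orthogonal f)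
    show "L2inner M f (u q) = L2inner M (u q) (u q)" if "q \<in> ?I" for q
    proof (cases q)
      case None
      then show ?thesis by (simp add: u_def L2inner_def Lam_def prob_space)
    qed (use that L2inner_Delta_self[OF f] in \<open>auto simp: u_def\<close>)
  qed (use fin sq f in auto)
  ultimately show ?thesis by simp
qed

lemma sq_int_haar_psum: "sq_int M f \<Longrightarrow> sq_int M (haar_psum c M H w P f N)"
  unfolding haar_psum_def[abs_def] by (intro sq_int_sum sq_int_Delta)

lemma sum_gen_energy_le:
  assumes f: "sq_int M f"
  shows "(\<Sum>k<N. gen_energy P f w k) \<le> (L2norm M f)\<^sup>2"
proof -
  let ?S = "SIGMA k:{..<N}. {j\<in>idx k. tr w k j \<and> P k j}"
  have fin: "finite ?S" by (intro finite_SigmaI) auto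
  have "L2norm M (\<lambda>x. \<Sum>q\<in>?S. D w (fst q) (snd q) f x) \<le> L2norm M f"
    using fin f L2inner_Delta_self[OF f]
    by (intro L2norm_orthogonal_projection_le) (auto intro!: sq_int_Delta Delta_orthogonal)
  then have "(L2norm M (\<lambda>x. \<Sum>k<N. \<Sum>j\<in>{j\<in>idx k. tr w k j \<and> P k j}. D w k j f x))\<^sup>2 \<le> (L2norm M f)\<^sup>2"
    by (intro power_mono) (simp_all add: sum.Sigma split_beta)
  then show ?thesis using L2norm_haar_sum[OF f, of "{..<N}" w P] by simp
qed

text \<open>\<open>haar_part\<close> is a choice, so a limit must be shown to exist. Bessel makes
  the energies summable, and by Pythagoras their tails are the squared distances between partial
  sums.\<close>

lemma haar_part_limit:
  assumes f: "sq_int M f"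
  shows "sq_int M (haar_part c M H w P f)"
    and "(\<lambda>N. L2norm M (\<lambda>x. haar_psum c M H w P f N x - haar_part c M H w P f x)) \<longlonglongrightarrow> 0"
proof -
  let ?s = "haar_psum c M H w P f"
  define S where "S N = (\<Sum>k<N. gen_energy P f w k)" for N
  have diff: "(L2norm M (\<lambda>x. ?s m x - ?s n x))\<^sup>2 = S m - S n" if "n \<le> m" for m n
  proof -
    have split: "(\<Sum>k<m. g k) - (\<Sum>k<n. g k) = (\<Sum>k\<in>{n..<m}. g k)" for g :: "nat \<Rightarrow> 'b::ab_group_add"
      using sum_diff_nat_ivl[of 0 n m g] that by (simp add: lessThan_atLeast0)
    show ?thesis
      using L2norm_haar_sum[OF f, of "{n..<m}" w P] by (simp add: haar_psum_def S_def split)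
  qed
  have "summable (gen_energy P f w)"
    using sum_gen_energy_le[OF f, of P w] gen_energy_nonneg by (intro summableI_nonneg_bounded)
  then have "Cauchy S"
    unfolding S_def by (simp add: summable_iff_convergent Cauchy_convergent_iff)
  have "\<exists>h. sq_int M h \<and> (\<lambda>N. L2norm M (\<lambda>x. ?s N x - h x)) \<longlonglongrightarrow> 0"
  proof (rule L2_limit_exists)
    fix e :: real assume "0 < e"
    then obtain N where N: "\<And>m n. N \<le> m \<Longrightarrow> N \<le> n \<Longrightarrow> \<bar>S m - S n\<bar> < e"
      using CauchyD[OF \<open>Cauchy S\<close> \<open>0 < e\<close>] by auto
    have "(L2norm M (\<lambda>x. ?s m x - ?s n x))\<^sup>2 \<le> e" if "N \<le> m" "N \<le> n" for m n
      using N[OF that] diff[of n m] diff[of m n] L2norm_minus_commute[of M "?s m" "?s n"]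
      by (cases "n \<le> m") auto
    then show "\<exists>N. \<forall>m\<ge>N. \<forall>n\<ge>N. (L2norm M (\<lambda>x. ?s m x - ?s n x))\<^sup>2 \<le> e" by blast
  qed (use sq_int_haar_psum[OF f] prob_space_axioms in auto)
  from someI_ex[OF this] show "sq_int M (haar_part c M H w P f)"
    and "(\<lambda>N. L2norm M (\<lambda>x. ?s N x - haar_part c M H w P f x)) \<longlonglongrightarrow> 0"
    unfolding haar_part_def by blast+
qed

text \<open>Parseval for the selected cubes, by continuity of the norm. The norm of
  \<open>haar_part\<close> therefore does not depend on which limit was chosen.\<close>

lemma gen_energy_sums:
  assumes f: "sq_int M f"
  shows "gen_energy P f w sums (L2norm M (haar_part c M H w P f))\<^sup>2"
proof -
  let ?s = "haar_psum c M H w P f" and ?h = "haar_part c M H w P f"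
  have "(\<lambda>N. L2norm M (?s N) - L2norm M ?h) \<longlonglongrightarrow> 0"
    using haar_part_limit(2)[OF f, of w P]
    by (rule Lim_null_comparison[rotated])
      (auto intro!: always_eventually L2norm_triangle_diff sq_int_haar_psum haar_part_limit(1) f)
  then have "(\<lambda>N. L2norm M (?s N)) \<longlonglongrightarrow> L2norm M ?h" by (simp add: LIM_zero_iff)
  then have "(\<lambda>N. (L2norm M (?s N))\<^sup>2) \<longlonglongrightarrow> (L2norm M ?h)\<^sup>2" by (intro tendsto_intros)
  moreover have "(L2norm M (?s N))\<^sup>2 = (\<Sum>k<N. gen_energy P f w k)" for N
    using L2norm_haar_sum[OF f, of "{..<N}" w P] by (simp add: haar_psum_def[abs_def])
  ultimately show ?thesis by (simp add: sums_def)
qed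

lemma L2norm_good_part_le:
  assumes f: "sq_int M f"
  shows "L2norm M (good_part c M H r \<alpha> w w' f) \<le> L2norm M f"
proof -
  define P where "P k j = (\<not> bad c r \<alpha> w w' k j)" for k j
  let ?s = "haar_psum c M H w P f" and ?h = "haar_part c M H w P f"
  have "L2norm M (\<lambda>x. Lam M f + ?h x) \<le> L2norm M f + L2norm M (\<lambda>x. ?s N x - ?h x)" for N
  proof -
    have "L2norm M (\<lambda>x. (Lam M f + ?s N x) + (?h x - ?s N x))
        \<le> L2norm M (\<lambda>x. Lam M f + ?s N x) + L2norm M (\<lambda>x. ?h x - ?s N x)"
      by (intro L2norm_triangle sq_int_add sq_int_diff sq_int_const sq_int_haar_psum haar_part_limit(1) f)
    also have "\<dots> \<le> L2norm M f + L2norm M (\<lambda>x. ?s N x - ?h x)"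
      using L2norm_Lam_add_haar_psum[OF f, of w P N] L2norm_minus_commute[of M ?h "?s N"] by simp
    finally show ?thesis by simp
  qed
  moreover have "(\<lambda>N. L2norm M f + L2norm M (\<lambda>x. ?s N x - ?h x)) \<longlonglongrightarrow> L2norm M f + 0"
    by (intro tendsto_intros haar_part_limit f)
  ultimately have "L2norm M (\<lambda>x. Lam M f + ?h x) \<le> L2norm M f"
    by (intro LIMSEQ_le_const) auto
  then show ?thesis by (simp add: good_part_def P_def[abs_def])
qed

lemma sq_int_good_part: "sq_int M f \<Longrightarrow> sq_int M (good_part c M H r \<alpha> w w' f)"
  unfolding good_part_def by (intro sq_int_add sq_int_const haar_part_limit(1))

lemma sq_int_bad_part: "sq_int M f \<Longrightarrow> sq_int M (bad_part c M H r \<alpha> w w' f)"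
  unfolding bad_part_def by (rule haar_part_limit(1))

section \<open>Integral operators with bounded kernel\<close>

lemma L2norm_le_bound:
  assumes "u \<in> borel_measurable M" "\<And>x. cmod (u x) \<le> B"
  shows "L2norm M u \<le> B"
proof -
  have "0 \<le> B" using assms(2)[of undefined] norm_ge_zero order_trans by blast
  have "(\<integral>x. (cmod (u x))\<^sup>2 \<partial>M) \<le> (\<integral>x. B\<^sup>2 \<partial>M)"
    using sq_int_bounded[OF finite_measure_axioms assms] assms(2)
    by (intro integral_mono) (auto simp: sq_int_def intro!: power_mono)
  then have "(L2norm M u)\<^sup>2 \<le> B\<^sup>2" by (simp add: L2norm_power2 prob_space)
  then show ?thesis using \<open>0 \<le> B\<close> by (rule power2_le_imp_le)
qed

context
  fixes K :: "real^'n \<Rightarrow> real^'n \<Rightarrow> complex" and B :: real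
  assumes K_meas: "(\<lambda>(x, y). K x y) \<in> borel_measurable (M \<Otimes>\<^sub>M M)"
    and K_bound: "\<And>x y. cmod (K x y) \<le> B"
begin

lemma measurable_intop:
  assumes "sq_int M u"
  shows "intop M K u \<in> borel_measurable M"
proof -
  have [measurable]: "u \<in> borel_measurable M" using assms by (rule sq_int_measurable)
  have "(\<lambda>(x, y). K x y * u y) = (\<lambda>p. (\<lambda>(x, y). K x y) p * u (snd p))" by auto
  also have "\<dots> \<in> borel_measurable (M \<Otimes>\<^sub>M M)"
    by (intro borel_measurable_times K_meas) measurable
  finally show ?thesis unfolding intop_def by (rule borel_measurable_lebesgue_integral)
qed

text \<open>Cauchy-Schwarz in \<open>y\<close> for fixed \<open>x\<close>. Uniformity in
  \<open>x\<close> makes the image square integrable and gives an a priori operator bound.\<close>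

lemma intop_bound:
  assumes u: "sq_int M u"
  shows "cmod (intop M K u x) \<le> B * L2norm M u"
proof -
  \<comment> \<open>This conjugate undoes the one built into \<open>L2inner\<close>.\<close>
  let ?v = "\<lambda>y. cnj (K x y)"
  have "(\<lambda>y. (\<lambda>(x, y). K x y) (x, y)) \<in> borel_measurable M"
    by (rule measurable_compose[OF _ K_meas]) (simp add: sets_M sets_eq_imp_space_eq)
  then have v: "?v \<in> borel_measurable M" by simp
  have "cmod (L2inner M u ?v) \<le> L2norm M u * L2norm M ?v"
    using K_bound by (intro L2_Cauchy_Schwarz u sq_int_bounded[OF finite_measure_axioms v]) simp
  also have "\<dots> \<le> L2norm M u * B"
    using K_bound by (intro mult_left_mono L2norm_le_bound v) auto
  finally show ?thesis by (simp add: L2inner_def intop_def mult.commute)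
qed

lemma sq_int_intop: "sq_int M u \<Longrightarrow> sq_int M (intop M K u)"
  by (rule sq_int_bounded[OF finite_measure_axioms measurable_intop intop_bound])

lemma L2norm_intop_bound: "sq_int M u \<Longrightarrow> L2norm M (intop M K u) \<le> B * L2norm M u"
  by (rule L2norm_le_bound[OF measurable_intop intop_bound])

text \<open>\<open>opnorm\<close> is a supremum of reals, so it dominates its members only once the
  set is bounded above; the kernel bound \<open>B\<close> provides this.\<close>

lemma L2norm_intop_le_opnorm:
  assumes "sq_int M u" "L2norm M u \<le> 1"
  shows "L2norm M (intop M K u) \<le> opnorm M K"
  unfolding opnorm_def
proof (rule cSup_upper)
  have "0 \<le> B" using K_bound[of undefined undefined] norm_ge_zero order_trans by blast
  have "L2norm M (intop M K v) \<le> B" if "sq_int M v" "L2norm M v \<le> 1" for v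
    using L2norm_intop_bound[OF that(1)] mult_left_mono[OF that(2) \<open>0 \<le> B\<close>] by simp
  then show "bdd_above {L2norm M (intop M K f) |f. sq_int M f \<and> L2norm M f \<le> 1}"
    by (intro bdd_aboveI[of _ B]) auto
qed (use assms in auto)

lemma opnorm_nonneg: "0 \<le> opnorm M K"
proof -
  have "L2norm M (intop M K (\<lambda>x. 0)) \<le> opnorm M K"
    by (rule L2norm_intop_le_opnorm) (auto simp: sq_int_zero L2norm_def)
  with L2norm_nonneg show ?thesis by (rule order_trans)
qed

lemma L2norm_intop_le:
  assumes u: "sq_int M u"
  shows "L2norm M (intop M K u) \<le> opnorm M K * L2norm M u"
proof (cases "L2norm M u = 0")
  case True
  \<comment> \<open>A function of norm zero cannot be normalized; the cruder bound with
    \<open>B\<close> gives zero directly.\<close>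
  then show ?thesis using L2norm_intop_bound[OF u] by simp
next
  case False
  then have pos: "0 < L2norm M u" by (simp add: order_less_le)
  define a where "a = complex_of_real (1 / L2norm M u)"
  have a: "cmod a = 1 / L2norm M u" using pos by (simp add: a_def norm_divide)
  have "intop M K (\<lambda>x. a * u x) = (\<lambda>x. a * intop M K u x)"
    by (simp add: intop_def mult.left_commute[of _ a])
  then have "L2norm M (\<lambda>x. a * intop M K u x) \<le> opnorm M K"
    using L2norm_intop_le_opnorm[OF sq_int_cmult[OF u, of a]] pos by (simp add: L2norm_cmult a)
  then show ?thesis using pos by (simp add: L2norm_cmult a field_simps)
qed

lemma L2inner_intop_le:
  assumes "sq_int M u" "sq_int M v"
  shows "cmod (L2inner M (intop M K u) v) \<le> opnorm M K * L2norm M u * L2norm M v"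
  using L2_Cauchy_Schwarz[OF sq_int_intop[OF assms(1)] assms(2)]
    mult_right_mono[OF L2norm_intop_le[OF assms(1)] L2norm_nonneg[of M v]] by linarith

text \<open>Once the good part is bounded by \<open>f\<close>, the shifts enter only through the
  norms of the two bad parts. The cubes tested for \<open>g\<close> come from the second lattice,
  hence the swapped \<open>w' w\<close>.\<close>

lemma cmod_Rterm_le:
  assumes f: "sq_int M f" and g: "sq_int M g"
  shows "cmod (Rterm c M H r \<alpha> K w w' f g) \<le>
    opnorm M K * (L2norm M g * L2norm M (bad_part c M H r \<alpha> w w' f)
      + L2norm M f * L2norm M (bad_part c M H r \<alpha> w' w g))"
proof -
  have "cmod (Rterm c M H r \<alpha> K w w' f g) \<le>
      opnorm M K * L2norm M (bad_part c M H r \<alpha> w w' f) * L2norm M g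
      + opnorm M K * L2norm M (good_part c M H r \<alpha> w w' f) * L2norm M (bad_part c M H r \<alpha> w' w g)"
    unfolding Rterm_def
    by (intro order_trans[OF norm_triangle_ineq] add_mono L2inner_intop_le sq_int_bad_part sq_int_good_part f g)
  also have "\<dots> \<le> opnorm M K * L2norm M (bad_part c M H r \<alpha> w w' f) * L2norm M g
      + opnorm M K * L2norm M f * L2norm M (bad_part c M H r \<alpha> w' w g)"
    by (intro add_left_mono mult_right_mono mult_left_mono L2norm_good_part_le f opnorm_nonneg L2norm_nonneg)
  finally show ?thesis by (simp add: algebra_simps)
qed

end

end

section \<open>Measurability in the shifts\<close>

text \<open>Compact pieces are wanted because the difference of a closed and a compact set is
  closed.\<close>

lemma cube_eq_UN_cbox:
  fixes a :: "real^'n"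
  shows "cube a l = (\<Union>n. cbox a (\<chi> i. a$i + l - inverse (real (Suc n))))"
proof (intro equalityI subsetI)
  fix x assume x: "x \<in> cube a l"
  \<comment> \<open>There are finitely many coordinates, so one positive gap serves them
    all.\<close>
  define d where "d = Min (range (\<lambda>i. a$i + l - x$i))"
  have "0 < d" using x by (simp add: d_def cube_def)
  then obtain n where n: "inverse (real (Suc n)) < d" using reals_Archimedean by blast
  have "d \<le> a$i + l - x$i" for i by (simp add: d_def)
  then have "x$i \<le> a$i + l - inverse (real (Suc n))" for i using n by (smt (verit))
  then have "x \<in> cbox a (\<chi> i. a$i + l - inverse (real (Suc n)))"
    using x by (simp add: mem_box_cart cube_def)
  then show "x \<in> (\<Union>n. cbox a (\<chi> i. a$i + l - inverse (real (Suc n))))" by blast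
next
  fix x assume "x \<in> (\<Union>n. cbox a (\<chi> i. a$i + l - inverse (real (Suc n))))"
  then obtain n where n: "x \<in> cbox a (\<chi> i. a$i + l - inverse (real (Suc n)))" by blast
  have "0 < inverse (real (Suc n))" by simp
  with n show "x \<in> cube a l"
    unfolding cube_def mem_box_cart by (simp del: inverse_positive_iff_positive) (smt (verit))
qed

text \<open>With both sets moving, the distance becomes that of the single point
  \<open>a - b\<close> from a fixed set, which is visibly continuous in the shifts.\<close>

lemma setdist_translation_eq:
  fixes a b :: "'a::real_normed_vector"
  shows "setdist ((+) a ` S) ((+) b ` T) = setdist {a - b} (\<Union>s\<in>S. \<Union>t\<in>T. {t - s})"
proof -
  let ?U = "\<Union>s\<in>S. \<Union>t\<in>T. {t - s}"
  have d: "dist (a + s) (b + t) = dist (a - b) (t - s)" for s t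
    by (simp add: dist_norm algebra_simps)
  have "{dist x y |x y. x \<in> (+) a ` S \<and> y \<in> (+) b ` T} = {dist (a - b) (t - s) |s t. s \<in> S \<and> t \<in> T}"
    unfolding d[symmetric] by blast
  moreover have "{dist x y |x y. x \<in> {a - b} \<and> y \<in> ?U} = {dist (a - b) (t - s) |s t. s \<in> S \<and> t \<in> T}"
    by blast
  \<comment> \<open>\<open>setdist\<close> is 0 by convention when a set is empty, so emptiness has
    to agree on the two sides.\<close>
  moreover have "((+) a ` S = {} \<or> (+) b ` T = {}) = ({a - b} = {} \<or> ?U = {})" by auto
  ultimately show ?thesis unfolding setdist_def by presburger
qed

lemma cube_index_translation: "cube_index c w k x = cube_index c 0 k (x - w)"
  by (simp add: cube_index_def algebra_simps)

lemma mem_translation_iff: "x \<in> (+) w ` A \<longleftrightarrow> x - w \<in> A" for x w :: "'a::ab_group_add"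
proof
  assume "x - w \<in> A"
  then have "w + (x - w) \<in> (+) w ` A" by (rule imageI)
  then show "x \<in> (+) w ` A" by simp
qed auto

lemma dcube_translation: "dcube c w k j = (+) w ` dcube c 0 k j"
  by (rule set_eqI) (simp only: mem_dcube_iff mem_translation_iff cube_index_translation[of c w])

lemma sk_translation: "sk c w k j = (+) w ` sk c 0 k j"
  unfolding sk_def dcube_translation[of c w] frontier_translation image_UN ..

text \<open>For each candidate \<open>R\<close>, badness is a strict inequality for a continuous
  function of the two shifts; the existential quantifiers give a union of open sets.\<close>

lemma open_bad: "open {p. bad c r \<alpha> (fst p) (snd p) k j}"
proof -
  have "open {p. side k' \<ge> 2 powr (real_of_int r) * side k \<and>
      setdist (dcube c (fst p) k j) (sk c (snd p) k' j') < side k powr \<alpha> * side k' powr (1 - \<alpha>)}" for k' j'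
  proof -
    have "continuous_on UNIV (\<lambda>p. setdist {fst p - snd p :: real^'a}
        (\<Union>s\<in>dcube c 0 k j. \<Union>t\<in>sk c 0 k' j'. {t - s}))"
      by (intro continuous_on_compose2[OF continuous_on_setdist[of UNIV]] continuous_intros) auto
    then show ?thesis
      unfolding dcube_translation[of c "fst _"] sk_translation[of c "snd _"] setdist_translation_eq
      by (intro open_Collect_conj open_Collect_const open_Collect_less continuous_on_const)
  qed
  then have "open (\<Union>k'. \<Union>j'\<in>idx k'. {p. side k' \<ge> 2 powr (real_of_int r) * side k \<and>
      setdist (dcube c (fst p) k j) (sk c (snd p) k' j') < side k powr \<alpha> * side k' powr (1 - \<alpha>)})"
    by (intro open_UN ballI)
  also have "(\<Union>k'. \<Union>j'\<in>idx k'. {p. side k' \<ge> 2 powr (real_of_int r) * side k \<and>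
      setdist (dcube c (fst p) k j) (sk c (snd p) k' j') < side k powr \<alpha> * side k' powr (1 - \<alpha>)})
    = {p. bad c r \<alpha> (fst p) (snd p) k j}"
    by (auto simp: bad_def)
  finally show ?thesis .
qed

lemma pred_bad: "Measurable.pred (borel \<Otimes>\<^sub>M borel) (\<lambda>p. bad c r \<alpha> (fst p) (snd p) k j)"
  using borel_open[OF open_bad] by (simp add: pred_def borel_prod)

lemma dbl_dcube_translation: "dbl_dcube c w k j = {x. x - w \<in> dbl_dcube c 0 k j}"
  by (auto simp: dbl_dcube_def cube_def dcorner_def algebra_simps)

text \<open>Inclusion fails exactly when \<open>w = y - x\<close> with \<open>y\<close> outside
  \<open>H\<close> and \<open>x\<close> in the unshifted doubled cube. Exhausting that cube by
  compact boxes makes the set of failures a countable union of closed sets.\<close>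

lemma sets_dbl_dcube_subset:
  fixes c :: "real^'n"
  assumes "open H"
  shows "{w. dbl_dcube c w k j \<subseteq> H} \<in> sets borel"
proof -
  define a where "a = dcorner c 0 k j - (\<chi> i. side k / 2)"
  define C where "C n = cbox a (\<chi> i. a$i + 2 * side k - inverse (real (Suc n)))" for n
  have C: "dbl_dcube c 0 k j = (\<Union>n. C n)"
    unfolding dbl_dcube_def a_def[symmetric] cube_eq_UN_cbox C_def ..
  have "closed (\<Union>y\<in>-H. \<Union>x\<in>C n. {y - x})" for n
    using assms by (intro closed_compact_differences) (auto simp: C_def)
  then have "(\<Union>n. \<Union>y\<in>-H. \<Union>x\<in>C n. {y - x}) \<in> sets borel" by (intro sets.countable_UN) auto
  then have "- (\<Union>n. \<Union>y\<in>-H. \<Union>x\<in>C n. {y - x}) \<in> sets borel" by (rule borel_comp)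
  also have "- (\<Union>n. \<Union>y\<in>-H. \<Union>x\<in>C n. {y - x}) = {w. dbl_dcube c w k j \<subseteq> H}"
  proof (rule set_eqI)
    fix w :: "real^'n"
    have "(\<exists>x\<in>A. w = y - x) \<longleftrightarrow> y - w \<in> A" for A and y :: "real^'n"
    proof
      assume "y - w \<in> A"
      then show "\<exists>x\<in>A. w = y - x" by (rule bexI[rotated]) simp
    qed auto
    then have "w \<in> (\<Union>n. \<Union>y\<in>-H. \<Union>x\<in>C n. {y - x}) \<longleftrightarrow> (\<exists>y\<in>-H. y - w \<in> (\<Union>n. C n))"
      by simp blast
    moreover have "dbl_dcube c w k j \<subseteq> H \<longleftrightarrow> \<not> (\<exists>y\<in>-H. y - w \<in> (\<Union>n. C n))"
      unfolding dbl_dcube_translation[of c w] C by blast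
    ultimately show "w \<in> - (\<Union>n. \<Union>y\<in>-H. \<Union>x\<in>C n. {y - x}) \<longleftrightarrow> w \<in> {w. dbl_dcube c w k j \<subseteq> H}"
      by (simp only: Compl_iff mem_Collect_eq)
  qed
  finally show ?thesis .
qed

section \<open>Measurability of the energies and of the norms of the bad parts\<close>

context haar_system
begin

lemma measurable_indicator_dcube [measurable]:
  "(\<lambda>p. indicator (Q (fst p) k j) (snd p) :: real) \<in> borel_measurable (borel \<Otimes>\<^sub>M M)"
proof -
  have "sets (borel \<Otimes>\<^sub>M M) = sets (borel \<Otimes>\<^sub>M (borel :: (real^'n) measure))"
    by (intro sets_pair_measure_cong sets_M refl)
  then have "(indicator {p. snd p \<in> Q (fst p) k j} :: _ \<Rightarrow> real) \<in> borel_measurable (borel \<Otimes>\<^sub>M M)"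
    using sets_dcube_pair[of k j] by (intro borel_measurable_indicator) simp
  also have "indicator {p. snd p \<in> Q (fst p) k j} = (\<lambda>p. indicator (Q (fst p) k j) (snd p) :: real)"
    by (auto simp: indicator_def)
  finally show ?thesis .
qed

lemma measurable_measure_dcube [measurable]: "(\<lambda>w. measure M (Q w k j)) \<in> borel_measurable borel"
proof -
  have "(\<lambda>w. \<integral>x. indicator (Q w k j) x \<partial>M :: real) \<in> borel_measurable borel"
    using measurable_indicator_dcube[of k j] by (intro borel_measurable_lebesgue_integral) (simp add: split_beta')
  then show ?thesis by (simp add: sets.Int_space_eq2[OF sets_dcube])
qed

lemma measurable_avg:
  assumes f: "sq_int M f"
  shows "(\<lambda>w. avg M (Q w k j) f) \<in> borel_measurable borel"
proof -
  have [measurable]: "f \<in> borel_measurable M" using f by (rule sq_int_measurable)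
  have "(\<lambda>p. indicator (Q (fst p) k j) (snd p) *\<^sub>R f (snd p)) \<in> borel_measurable (borel \<Otimes>\<^sub>M M)"
    by measurable
  then have "(\<lambda>w. \<integral>x. indicator (Q w k j) x *\<^sub>R f x \<partial>M) \<in> borel_measurable borel"
    by (intro borel_measurable_lebesgue_integral) (simp add: split_beta')
  then show ?thesis unfolding avg_def by measurable
qed

lemma pred_transit [measurable]:
  assumes "open H"
  shows "Measurable.pred borel (\<lambda>w. tr w k j)"
proof -
  have [measurable]: "Measurable.pred borel (\<lambda>w. dbl_dcube c w k j \<subseteq> H)"
    using sets_dbl_dcube_subset[OF assms] by (simp add: pred_def)
  show ?thesis unfolding transit_def terminal_def by measurable
qed

lemma measurable_L2norm_Delta:
  assumes f: "sq_int M f" and H: "open H"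
  shows "(\<lambda>w. (L2norm M (D w k j f))\<^sup>2) \<in> borel_measurable borel"
proof -
  have [measurable]: "f \<in> borel_measurable M" using f by (rule sq_int_measurable)
  note [measurable] = measurable_avg[OF f] pred_transit[OF H]
  have "(\<lambda>p. (cmod (D (fst p) k j f (snd p)))\<^sup>2) \<in> borel_measurable (borel \<Otimes>\<^sub>M M)"
    unfolding Delta_sum by measurable
  then show ?thesis
    unfolding L2norm_power2 by (intro borel_measurable_lebesgue_integral) (simp add: split_beta')
qed

text \<open>The set of transit cubes moves with the shift. Absorbing that condition here lets sums
  run over the fixed set \<open>idx k\<close>, with badness as a separate factor; only the shift of
  the cube's own lattice enters.\<close>

definition energy :: "(real^'n \<Rightarrow> complex) \<Rightarrow> nat \<Rightarrow> int^'n \<Rightarrow> real^'n \<Rightarrow> real" where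
  "energy f k j w = (if tr w k j then (L2norm M (D w k j f))\<^sup>2 else 0)"

lemma energy_nonneg: "0 \<le> energy f k j w"
  by (simp add: energy_def)

lemma measurable_energy: "sq_int M f \<Longrightarrow> open H \<Longrightarrow> energy f k j \<in> borel_measurable borel"
  unfolding energy_def[abs_def]
  by (intro measurable_If measurable_L2norm_Delta) (simp_all add: pred_transit flip: pred_def)

lemma gen_energy_alt: "gen_energy P f w k = (\<Sum>j\<in>idx k. indicator (Collect (P k)) j * energy f k j w)"
proof -
  have "{j \<in> idx k. tr w k j \<and> P k j} = {j \<in> idx k. P k j \<and> tr w k j}" by auto
  then have "gen_energy P f w k = (\<Sum>j\<in>idx k. if P k j \<and> tr w k j then (L2norm M (D w k j f))\<^sup>2 else 0)"
    by (simp add: gen_energy_def sum.inter_filter)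
  also have "\<dots> = (\<Sum>j\<in>idx k. indicator (Collect (P k)) j * energy f k j w)"
    by (intro sum.cong) (auto simp: energy_def indicator_def)
  finally show ?thesis .
qed

lemma measurable_bad_gen_energy:
  assumes "sq_int M f" "open H"
  shows "(\<lambda>p. gen_energy (bad c r \<alpha> (fst p) (snd p)) f (fst p) k) \<in> borel_measurable (borel \<Otimes>\<^sub>M borel)"
proof -
  note [measurable] = measurable_energy[OF assms] pred_bad
  have "(\<lambda>p. \<Sum>j\<in>idx k. (if bad c r \<alpha> (fst p) (snd p) k j then 1 else 0) * energy f k j (fst p))
      \<in> borel_measurable (borel \<Otimes>\<^sub>M borel)"
    by measurable
  then show ?thesis by (simp add: gen_energy_alt indicator_def of_bool_def)
qed

text \<open>The bad part is chosen separately for each pair of shifts, so its own joint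
  measurability is out of reach here. Its norm is the square root of a sum of measurable
  energies.\<close>

lemma measurable_L2norm_bad_part:
  assumes "sq_int M f" "open H"
  shows "(\<lambda>p. L2norm M (bad_part c M H r \<alpha> (fst p) (snd p) f)) \<in> borel_measurable (borel \<Otimes>\<^sub>M borel)"
proof -
  note [measurable] = measurable_bad_gen_energy[OF assms]
  have "L2norm M (bad_part c M H r \<alpha> w w' f) = sqrt (\<Sum>k. gen_energy (bad c r \<alpha> w w') f w k)" for w w'
    using sums_unique[OF gen_energy_sums[OF assms(1), of "bad c r \<alpha> w w'" w], symmetric]
    by (simp add: bad_part_def)
  then show ?thesis by simp
qed

end

section \<open>Averaging over the shifts\<close>

text \<open>\<open>Omega\<close> lies between an open and a closed box with the same corners, so its
  measure is positive and finite and the uniform measure is a probability.\<close>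

lemma emeasure_Omega:
  shows "emeasure lborel (Omega :: (real^'n) set) \<noteq> 0" and "emeasure lborel (Omega :: (real^'n) set) \<noteq> \<infinity>"
    and sets_Omega: "(Omega :: (real^'n) set) \<in> sets borel"
proof -
  let ?l = "(\<chi> i. - 1/40) :: real^'n" and ?u = "(\<chi> i. 1/40) :: real^'n"
  have "(Omega :: (real^'n) set) = (\<Inter>i. {w. - 1/40 < w$i} \<inter> {w. w$i \<le> 1/40})"
    by (auto simp: Omega_def)
  also have "\<dots> \<in> sets borel"
    by (intro sets.finite_INT sets.Int borel_open borel_closed open_Collect_less closed_Collect_le
        continuous_intros) auto
  finally show [measurable]: "(Omega :: (real^'n) set) \<in> sets borel" .
  have "0 < (\<Prod>b\<in>(Basis :: (real^'n) set). (?u - ?l) \<bullet> b)"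
    by (intro prod_pos) (auto simp: Basis_vec_def inner_axis)
  moreover have "emeasure lborel (box ?l ?u) = (\<Prod>b\<in>(Basis :: (real^'n) set). (?u - ?l) \<bullet> b)"
    by (intro emeasure_lborel_box) (auto simp: Basis_vec_def inner_axis)
  moreover have "emeasure lborel (box ?l ?u) \<le> emeasure lborel (Omega :: (real^'n) set)"
    by (intro emeasure_mono) (auto simp: Omega_def mem_box_cart intro: less_imp_le)
  ultimately show "emeasure lborel (Omega :: (real^'n) set) \<noteq> 0"
    by (metis ennreal_eq_0_iff le_zero_eq linorder_not_le)
  have "Omega \<subseteq> cbox ?l ?u"
    unfolding Omega_def by (fastforce simp: mem_box_cart intro: less_imp_le)
  then have "emeasure lborel (Omega :: (real^'n) set) \<le> emeasure lborel (cbox ?l ?u)"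
    by (intro emeasure_mono) auto
  also have "\<dots> < \<infinity>" by (rule emeasure_lborel_cbox_finite)
  finally show "emeasure lborel (Omega :: (real^'n) set) \<noteq> \<infinity>" by simp
qed

lemma sets_POmega [measurable_cong]: "sets POmega = sets borel"
  by (simp add: POmega_def)

lemma prob_space_POmega: "prob_space (POmega :: (real^'n) measure)"
  unfolding POmega_def by (rule prob_space_uniform_measure) (rule emeasure_Omega)+

lemma AE_POmega: "AE w in POmega. w \<in> Omega"
  unfolding POmega_def using sets_Omega by (intro AE_uniform_measureI) auto

text \<open>The joint law of the two shifts is symmetric. Thus the bad part of \<open>g\<close>,
  whose cubes belong to the second lattice, falls under the estimate for the first.\<close>

lemma nn_integral_pair_swap:
  assumes "sigma_finite_measure P" "g \<in> borel_measurable (P \<Otimes>\<^sub>M P)"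
  shows "(\<integral>\<^sup>+p. g (snd p, fst p) \<partial>(P \<Otimes>\<^sub>M P)) = (\<integral>\<^sup>+p. g p \<partial>(P \<Otimes>\<^sub>M P))"
proof -
  interpret pair_sigma_finite P P using assms(1) by (simp add: pair_sigma_finite_def)
  have "(\<integral>\<^sup>+p. g p \<partial>(P \<Otimes>\<^sub>M P)) = (\<integral>\<^sup>+p. g p \<partial>(distr (P \<Otimes>\<^sub>M P) (P \<Otimes>\<^sub>M P) (\<lambda>(x, y). (y, x))))"
    using distr_pair_swap by simp
  also have "\<dots> = (\<integral>\<^sup>+p. g (snd p, fst p) \<partial>(P \<Otimes>\<^sub>M P))"
    using assms(2) by (subst nn_integral_distr) (auto simp: split_beta')
  finally show ?thesis by simp
qed

section \<open>Mean size of the bad parts\<close>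

context haar_system
begin

text \<open>With \<open>w\<close> frozen, the squared norm is a series of fixed energies times
  indicators of events in \<open>w'\<close>, and it can be integrated term by term.\<close>

lemma nn_integral_bad_energy_le:
  fixes w :: "real^'n"
  assumes f: "sq_int M f" and w: "w \<in> Omega" and "0 < \<delta>"
    and bad: "\<And>k j. j \<in> idx k \<Longrightarrow> measure POmega {w'\<in>Omega. bad c r \<alpha> w w' k j} \<le> \<delta>\<^sup>2"
  shows "(\<integral>\<^sup>+w'. ennreal ((L2norm M (bad_part c M H r \<alpha> w w' f))\<^sup>2) \<partial>POmega) \<le> ennreal ((\<delta> * L2norm M f)\<^sup>2)"
proof -
  interpret P: prob_space "POmega :: (real^'n) measure" by (rule prob_space_POmega)
  define B where "B k j = {w'. bad c r \<alpha> w w' k j}" for k j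
  have "(\<lambda>w'. (w, w')) -` {p. bad c r \<alpha> (fst p) (snd p) k j} \<in> sets borel" for k j
    by (intro borel_open open_vimage open_bad continuous_intros)
  then have B: "B k j \<in> sets POmega" for k j
    by (simp add: B_def vimage_def sets_POmega)
  have prob_B: "emeasure POmega (B k j) \<le> ennreal (\<delta>\<^sup>2)" if "j \<in> idx k" for k j
  proof -
    \<comment> \<open>The probability bound is stated inside \<open>Omega\<close>, whereas
      \<open>B k j\<close> ranges over all shifts; the two events differ by a null set.\<close>
    have "emeasure POmega (B k j) = emeasure POmega {w'\<in>Omega. bad c r \<alpha> w w' k j}"
      using AE_POmega B[of k j] sets_Omega
      by (intro emeasure_eq_AE) (auto simp: B_def sets_POmega Collect_conj_eq elim: eventually_mono)
    then show ?thesis using bad[OF that] by (simp add: P.emeasure_eq_measure ennreal_leI)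
  qed
  have "ennreal ((L2norm M (bad_part c M H r \<alpha> w w' f))\<^sup>2)
      = (\<Sum>k. \<Sum>j\<in>idx k. ennreal (energy f k j w) * indicator (B k j) w')" for w'
  proof -
    have "(L2norm M (bad_part c M H r \<alpha> w w' f))\<^sup>2 = (\<Sum>k. gen_energy (bad c r \<alpha> w w') f w k)"
      and "summable (gen_energy (bad c r \<alpha> w w') f w)"
      using gen_energy_sums[OF f, of "bad c r \<alpha> w w'" w]
      by (simp_all add: bad_part_def sums_iff)
    then have "ennreal ((L2norm M (bad_part c M H r \<alpha> w w' f))\<^sup>2) = (\<Sum>k. ennreal (gen_energy (bad c r \<alpha> w w') f w k))"
      by (simp add: suminf_ennreal2 gen_energy_nonneg)
    also have "(\<lambda>k. ennreal (gen_energy (bad c r \<alpha> w w') f w k))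
        = (\<lambda>k. \<Sum>j\<in>idx k. ennreal (energy f k j w) * indicator (B k j) w')"
    proof (rule ext)
      fix k
      have "ennreal (gen_energy (bad c r \<alpha> w w') f w k)
          = (\<Sum>j\<in>idx k. ennreal (indicator (Collect (bad c r \<alpha> w w' k)) j * energy f k j w))"
        unfolding gen_energy_alt by (subst sum_ennreal) (simp_all add: energy_nonneg)
      also have "\<dots> = (\<Sum>j\<in>idx k. ennreal (energy f k j w) * indicator (B k j) w')"
        by (intro sum.cong refl) (simp add: B_def indicator_def)
      finally show "ennreal (gen_energy (bad c r \<alpha> w w') f w k)
          = (\<Sum>j\<in>idx k. ennreal (energy f k j w) * indicator (B k j) w')" .
    qed
    finally show ?thesis .
  qed
  then have "(\<integral>\<^sup>+w'. ennreal ((L2norm M (bad_part c M H r \<alpha> w w' f))\<^sup>2) \<partial>POmega)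
      = (\<integral>\<^sup>+w'. (\<Sum>k. \<Sum>j\<in>idx k. ennreal (energy f k j w) * indicator (B k j) w') \<partial>POmega)" by simp
  also have "\<dots> = (\<Sum>k. \<Sum>j\<in>idx k. ennreal (energy f k j w) * emeasure POmega (B k j))"
  proof (subst nn_integral_suminf)
    show "(\<Sum>k. \<integral>\<^sup>+w'. (\<Sum>j\<in>idx k. ennreal (energy f k j w) * indicator (B k j) w') \<partial>POmega)
        = (\<Sum>k. \<Sum>j\<in>idx k. ennreal (energy f k j w) * emeasure POmega (B k j))"
      using B by (subst nn_integral_sum) (simp_all only: nn_integral_cmult_indicator borel_measurable_times_ennreal
          borel_measurable_const borel_measurable_indicator)
  qed (use B in measurable)
  also have "\<dots> \<le> (\<Sum>k. \<Sum>j\<in>idx k. ennreal (energy f k j w) * ennreal (\<delta>\<^sup>2))"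
    by (intro suminf_le sum_mono mult_left_mono prob_B) auto
  \<comment> \<open>With the probabilities replaced by the common bound, the energies of all transit
    cubes remain, ready for Bessel.\<close>
  also have "\<dots> = ennreal (\<delta>\<^sup>2) * (\<Sum>k. ennreal (gen_energy (\<lambda>_ _. True) f w k))"
    by (simp add: gen_energy_alt energy_nonneg mult.commute[of _ "ennreal (\<delta>\<^sup>2)"] ennreal_suminf_cmult
        flip: sum_distrib_left)
  also have "(\<Sum>k. ennreal (gen_energy (\<lambda>_ _. True) f w k)) \<le> ennreal ((L2norm M f)\<^sup>2)"
  proof (rule suminf_le_const)
    show "(\<Sum>k<n. ennreal (gen_energy (\<lambda>_ _. True) f w k)) \<le> ennreal ((L2norm M f)\<^sup>2)" for n
      using sum_gen_energy_le[OF f, of "\<lambda>_ _. True" w n] gen_energy_nonneg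
      by (simp add: ennreal_leI)
  qed simp
  finally show ?thesis
    by (simp add: power_mult_distrib ennreal_mult mult_left_mono)
qed

lemma nn_integral_L2norm_bad_part_le:
  assumes f: "sq_int M f" and H: "open H" and "0 < \<delta>"
    and bad: "\<And>w k j. w \<in> Omega \<Longrightarrow> j \<in> idx k \<Longrightarrow> measure POmega {w'\<in>Omega. bad c r \<alpha> w w' k j} \<le> \<delta>\<^sup>2"
  shows "(\<integral>\<^sup>+p. ennreal (L2norm M (bad_part c M H r \<alpha> (fst p) (snd p) f)) \<partial>(POmega \<Otimes>\<^sub>M POmega))
    \<le> ennreal (\<delta> * L2norm M f)"
proof (rule ennreal_power2_le_imp_le)
  interpret P: prob_space "POmega :: (real^'n) measure" by (rule prob_space_POmega)
  interpret PP: pair_prob_space "POmega :: (real^'n) measure" "POmega :: (real^'n) measure" ..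
  let ?PP = "POmega \<Otimes>\<^sub>M POmega :: ((real^'n) \<times> (real^'n)) measure"
  let ?b = "\<lambda>p. L2norm M (bad_part c M H r \<alpha> (fst p) (snd p) f)"
  have [measurable]: "?b \<in> borel_measurable ?PP"
    using measurable_L2norm_bad_part[OF f H]
    by (simp cong: measurable_cong_sets sets_pair_measure_cong add: sets_POmega)
  \<comment> \<open>Cauchy-Schwarz against 1 on the product probability space passes from the mean
    norm to the mean squared norm.\<close>
  have "(\<integral>\<^sup>+p. ennreal (?b p) * 1 \<partial>?PP)\<^sup>2
      \<le> (\<integral>\<^sup>+p. (ennreal (?b p))\<^sup>2 \<partial>?PP) * (\<integral>\<^sup>+p. 1\<^sup>2 \<partial>?PP)"
    by (rule Cauchy_Schwarz_nn_integral) measurable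
  also have "\<dots> = (\<integral>\<^sup>+p. ennreal ((?b p)\<^sup>2) \<partial>?PP)"
    using PP.emeasure_space_1 by (simp add: ennreal_power)
  also have "\<dots> = (\<integral>\<^sup>+w. \<integral>\<^sup>+w'. ennreal ((?b (w, w'))\<^sup>2) \<partial>POmega \<partial>POmega)"
    by (subst P.nn_integral_fst[symmetric]) simp_all
  also have "\<dots> \<le> (\<integral>\<^sup>+w. ennreal ((\<delta> * L2norm M f)\<^sup>2) \<partial>(POmega :: (real^'n) measure))"
  proof (rule nn_integral_mono_AE)
    show "AE w in POmega. (\<integral>\<^sup>+w'. ennreal ((?b (w, w'))\<^sup>2) \<partial>POmega) \<le> ennreal ((\<delta> * L2norm M f)\<^sup>2)"
      using AE_POmega
    proof eventually_elim
      case (elim w)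
      then show ?case
        using nn_integral_bad_energy_le[OF f elim \<open>0 < \<delta>\<close> bad[OF elim]] by simp
    qed
  qed
  also have "\<dots> = (ennreal (\<delta> * L2norm M f))\<^sup>2"
    using \<open>0 < \<delta>\<close> by (simp add: P.emeasure_space_1 ennreal_power)
  finally show "(\<integral>\<^sup>+p. ennreal (?b p) \<partial>?PP)\<^sup>2 \<le> (ennreal (\<delta> * L2norm M f))\<^sup>2" by simp
qed (use \<open>0 < \<delta>\<close> in simp)

end

section \<open>Expectation of the remainder over both shifts\<close>

theorem theorem17:
  fixes M :: "(real^'n) measure" and c :: "real^'n" and H :: "(real^'n) set"
    and K :: "real^'n \<Rightarrow> real^'n \<Rightarrow> complex"
    and \<tau> m \<delta> S :: real and r :: int
    and f g :: "real^'n \<Rightarrow> complex"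
  assumes "prob_space M" and "sets M = sets borel"
    and "\<exists>C. compact C \<and> C \<subseteq> cube (c + (\<chi> i. 3/8)) (1/4) \<and> emeasure M (UNIV - C) = 0"
    and "open H"
    and "(\<lambda>(x, y). K x y) \<in> borel_measurable (M \<Otimes>\<^sub>M M)"
    and "\<exists>B. \<forall>x y. cmod (K x y) \<le> B"
    and "0 < \<tau>" and "\<tau> \<le> 1" and "0 < m" and "0 < \<delta>" and "2 \<le> S"
    and "2 powr (- real_of_int r) \<le> \<delta> powr S" and "\<delta> powr S < 2 powr (- real_of_int r + 1)"
    and "\<forall>\<omega>a\<in>Omega. \<forall>k. \<forall>j\<in>idx k.
           measure POmega {\<omega>b\<in>Omega. bad c r (\<tau> / (2*\<tau> + 2*m)) \<omega>a \<omega>b k j} \<le> \<delta>^2"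
    and "sq_int M f" and "sq_int M g"
  shows "(\<integral>\<^sup>+ w. ennreal (cmod (Rterm c M H r (\<tau> / (2*\<tau> + 2*m)) K (fst w) (snd w) f g))
            \<partial>(POmega \<Otimes>\<^sub>M POmega))
         \<le> ennreal (2 * \<delta> * opnorm M K * L2norm M f * L2norm M g)"
proof -
  interpret prob_space M by fact
  interpret haar_system M c H by unfold_locales fact
  interpret P: prob_space "POmega :: (real^'n) measure" by (rule prob_space_POmega)
  define \<alpha> where "\<alpha> = \<tau> / (2*\<tau> + 2*m)"
  obtain B where B: "\<And>x y. cmod (K x y) \<le> B" using assms(6) by blast
  note f = \<open>sq_int M f\<close> and g = \<open>sq_int M g\<close> and H = \<open>open H\<close>
  let ?PP = "POmega \<Otimes>\<^sub>M POmega :: ((real^'n) \<times> (real^'n)) measure"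
  define F where "F p = ennreal (L2norm M (bad_part c M H r \<alpha> (fst p) (snd p) f))" for p
  define G where "G p = ennreal (L2norm M (bad_part c M H r \<alpha> (fst p) (snd p) g))" for p
  have sets_PP: "sets ?PP = sets (borel \<Otimes>\<^sub>M borel)"
    by (intro sets_pair_measure_cong sets_POmega)
  have [measurable]: "F \<in> borel_measurable ?PP" "G \<in> borel_measurable ?PP"
    using measurable_L2norm_bad_part[OF f H] measurable_L2norm_bad_part[OF g H]
    unfolding F_def[abs_def] G_def[abs_def] measurable_cong_sets[OF sets_PP refl] by measurable
  have bad: "measure POmega {w'\<in>Omega. bad c r \<alpha> w w' k j} \<le> \<delta>\<^sup>2" if "w \<in> Omega" "j \<in> idx k" for w k j
    using assms(14) that by (simp add: \<alpha>_def)
  \<comment> \<open>The remainder is not shown to be measurable in the shifts; monotonicity of the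
    non-negative integral applies regardless, and the majorant is measurable.\<close>
  have "(\<integral>\<^sup>+ w. ennreal (cmod (Rterm c M H r \<alpha> K (fst w) (snd w) f g)) \<partial>?PP)
      \<le> (\<integral>\<^sup>+ p. ennreal (opnorm M K) *
          (ennreal (L2norm M g) * F p + ennreal (L2norm M f) * G (snd p, fst p)) \<partial>?PP)"
  proof (rule nn_integral_mono)
    fix p :: "(real^'n) \<times> (real^'n)"
    have "ennreal (cmod (Rterm c M H r \<alpha> K (fst p) (snd p) f g)) \<le>
      ennreal (opnorm M K * (L2norm M g * L2norm M (bad_part c M H r \<alpha> (fst p) (snd p) f)
      + L2norm M f * L2norm M (bad_part c M H r \<alpha> (snd p) (fst p) g)))"
      by (intro ennreal_leI cmod_Rterm_le[OF assms(5) B f g])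
    then show "ennreal (cmod (Rterm c M H r \<alpha> K (fst p) (snd p) f g)) \<le> ennreal (opnorm M K) *
          (ennreal (L2norm M g) * F p + ennreal (L2norm M f) * G (snd p, fst p))"
      by (simp add: F_def G_def ennreal_mult ennreal_plus opnorm_nonneg[OF assms(5) B])
  qed
  also have "\<dots> = ennreal (opnorm M K) *
      (ennreal (L2norm M g) * (\<integral>\<^sup>+ p. F p \<partial>?PP) + ennreal (L2norm M f) * (\<integral>\<^sup>+ p. G (snd p, fst p) \<partial>?PP))"
    by (simp add: nn_integral_cmult nn_integral_add)
  also have "(\<integral>\<^sup>+ p. G (snd p, fst p) \<partial>?PP) = (\<integral>\<^sup>+ p. G p \<partial>?PP)"
    by (rule nn_integral_pair_swap) (auto intro: P.sigma_finite_measure_axioms)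
  also have "ennreal (opnorm M K) *
      (ennreal (L2norm M g) * (\<integral>\<^sup>+ p. F p \<partial>?PP) + ennreal (L2norm M f) * (\<integral>\<^sup>+ p. G p \<partial>?PP))
    \<le> ennreal (opnorm M K) *
      (ennreal (L2norm M g) * ennreal (\<delta> * L2norm M f) + ennreal (L2norm M f) * ennreal (\<delta> * L2norm M g))"
    unfolding F_def G_def
    by (intro mult_left_mono add_mono nn_integral_L2norm_bad_part_le f g H bad \<open>0 < \<delta>\<close>) auto
  \<comment> \<open>The contributions of the two bad parts are equal, which produces the factor
    2.\<close>
  also have "\<dots> = ennreal (opnorm M K * (L2norm M g * (\<delta> * L2norm M f) + L2norm M f * (\<delta> * L2norm M g)))"
    using \<open>0 < \<delta>\<close> by (simp add: opnorm_nonneg[OF assms(5) B] flip: ennreal_mult ennreal_plus)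
  also have "opnorm M K * (L2norm M g * (\<delta> * L2norm M f) + L2norm M f * (\<delta> * L2norm M g))
      = 2 * \<delta> * opnorm M K * L2norm M f * L2norm M g"
    by (simp add: algebra_simps)
  finally show ?thesis unfolding \<alpha>_def .
qed

end
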